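(* Let $\alpha\in(0,2)$, let $\Omega=(a_x,b_x)\times(a_y,b_y)\subset\mathbb{R}^2$ be a bounded rectangle, and let $u:\mathbb{R}^2\to\mathbb{R}$ satisfy $u=0$ on $\mathbb{R}^2\setminus\Omega$. Let $0<\varepsilon\le 1+\lfloor\alpha\rfloor-\alpha$ and assume $u\in C^{2+\lfloor\alpha\rfloor,\,\alpha-\lfloor\alpha\rfloor+\varepsilon}(\mathbb{R}^2)$. Then with splitting parameter $\gamma=2$ there is a constant $C>0$ independent of $h$ such that, for all sufficiently small $h=L/N$, $$\sup_{\mathbf{x}\in\Omega}\big|(-\Delta)^{\alpha/2}u(\mathbf{x})-(-\Delta)^{\alpha/2}_{h,2}u(\mathbf{x})\big|\le C h^{2}.$$
   Context: $\lfloor\cdot\rfloor$ is the floor function. For $k\in\mathbb{N}_0$, $s\in(0,1]$, $C^{k,s}(\mathbb{R}^d)$ is the space of functions $\mathbb{R}^d\to\mathbb{R}$ with continuous partial derivatives of all orders $\le k$ whose $k$-th order partial derivatives are uniformly Hölder continuous with exponent $s$. The fractional Laplacian is $(-\Delta)^{\alpha/2}u(\mathbf{x})=c_{d,\alpha}\,\mathrm{P.V.}\int_{\mathbb{R}^d}\frac{u(\mathbf{x})-u(\mathbf{x}')}{|\mathbf{x}-\mathbf{x}'|^{d+\alpha}}\,d\mathbf{x}'$ with $c_{d,\alpha}=\frac{2^{\alpha-1}\alpha\,\Gamma((d+\alpha)/2)}{\pi^{d/2}\Gamma(1-\alpha/2)}$. Two-dimensional discrete operator: let $L=\max\{b_x-a_x,b_y-a_y\}$,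 $N$ a positive integer, $h=L/N$, $\boldsymbol{\xi}_{ij}=(ih,jh)$, $I_{ij}=[ih,(i+1)h]\times[jh,(j+1)h]$, $D_1=(0,L)^2$, $D_2=[0,\infty)^2\setminus D_1$. For $\mathbf{x}=(x,y)$ and $\boldsymbol{\xi}=(\xi,\eta)\in[0,\infty)^2\setminus\{0\}$ set $\psi_\gamma(\mathbf{x},\boldsymbol{\xi})=|\boldsymbol{\xi}|^{-\gamma}\Big(\sum_{m,n\in\{0,1\}}u(x+(-1)^m\xi,\,y+(-1)^n\eta)-4u(\mathbf{x})\Big)$ and $\omega_\gamma(\boldsymbol{\xi})=|\boldsymbol{\xi}|^{\gamma-(2+\alpha)}$. Let $c^\gamma_{mn}=1$ for $(m,n)\in\{(1,0),(0,1),(1,1)\}$ when $\gamma\in(\alpha,2)$, and $c^2_{10}=c^2_{01}=2$, $c^2_{11}=0$ when $\gamma=2$. Define, for $\mathbf{x}\in\Omega$, $$(-\Delta)^{\alpha/2}_{h,\gamma}u(\mathbf{x})=-c_{2,\alpha}\Big[\tfrac14\Big(\sum_{(m,n)\in\{0,1\}^2\setminus\{(0,0)\}}c^\gamma_{mn}\psi_\gamma(\mathbf{x},\boldsymbol{\xi}_{mn})\Big)\int_{I_{00}}\omega_\gamma\,d\boldsymbol{\xi}+\tfrac14\sum_{\substack{0\le i,j\le N-1\\(i,j)\ne(0,0)}}\Big(\sum_{m,n\in\{0,1\}}\psi_\gamma(\mathbf{x},\boldsymbol{\xi}_{(i+m)(j+n)})\Big)\int_{I_{ij}}\omega_\gamma\,d\boldsymbol{\xi}-4u(\mathbf{x})\int_{D_2}|\boldsymbol{\xi}|^{-(2+\alpha)}d\boldsymbol{\xi}\Big].$$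 *)

theory Defs
  imports "HOL-Analysis.Analysis"
begin

text \<open>Points of R^2 are modelled as pairs (x,y) :: real \<times> real; the norm on
  real \<times> real is the Euclidean norm sqrt(x^2+y^2).\<close>

definition partial_x :: "(real \<times> real \<Rightarrow> real) \<Rightarrow> real \<times> real \<Rightarrow> real" where
  "partial_x f p = deriv (\<lambda>t. f (t, snd p)) (fst p)"

definition partial_y :: "(real \<times> real \<Rightarrow> real) \<Rightarrow> real \<times> real \<Rightarrow> real" where
  "partial_y f p = deriv (\<lambda>t. f (fst p, t)) (snd p)"

fun dpart :: "bool list \<Rightarrow> (real \<times> real \<Rightarrow> real) \<Rightarrow> real \<times> real \<Rightarrow> real" where
  "dpart [] f = f"
| "dpart (b # bs) f = (if b then partial_y else partial_x) (dpart bs f)"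

definition holder_space :: "nat \<Rightarrow> real \<Rightarrow> (real \<times> real \<Rightarrow> real) set" where
  "holder_space k s = {f.
     (\<forall>bs. length bs < k \<longrightarrow> (\<forall>p.
         (\<lambda>t. dpart bs f (t, snd p)) differentiable (at (fst p)) \<and>
         (\<lambda>t. dpart bs f (fst p, t)) differentiable (at (snd p)))) \<and>
     (\<forall>bs. length bs \<le> k \<longrightarrow> continuous_on UNIV (dpart bs f)) \<and>
     (\<forall>bs. length bs = k \<longrightarrow>
         (\<exists>C. \<forall>p q. \<bar>dpart bs f p - dpart bs f q\<bar> \<le> C * dist p q powr s))}"

definition c_const :: "real \<Rightarrow> real \<Rightarrow> real" where
  "c_const d \<alpha> = 2 powr (\<alpha> - 1) * \<alpha> * Gamma ((d + \<alpha>) / 2)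
                    / (pi powr (d / 2) * Gamma (1 - \<alpha> / 2))"

definition frac_lap :: "real \<Rightarrow> (real \<times> real \<Rightarrow> real) \<Rightarrow> real \<times> real \<Rightarrow> real" where
  "frac_lap \<alpha> u x = c_const 2 \<alpha> *
     Lim (at_right 0) (\<lambda>e. integral {x'. dist x x' > e}
            (\<lambda>x'. (u x - u x') / dist x x' powr (2 + \<alpha>)))"

definition psi_g :: "real \<Rightarrow> (real \<times> real \<Rightarrow> real) \<Rightarrow> real \<times> real \<Rightarrow> real \<times> real \<Rightarrow> real" where
  "psi_g \<gamma> u x \<xi> = norm \<xi> powr (-\<gamma>) *
     (u (fst x + fst \<xi>, snd x + snd \<xi>) + u (fst x + fst \<xi>, snd x - snd \<xi>)
    + u (fst x - fst \<xi>, snd x + snd \<xi>) + u (fst x - fst \<xi>, snd x - snd \<xi>) - 4 * u x)"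

definition omega_g :: "real \<Rightarrow> real \<Rightarrow> real \<times> real \<Rightarrow> real" where
  "omega_g \<alpha> \<gamma> \<xi> = norm \<xi> powr (\<gamma> - (2 + \<alpha>))"

definition c_coef :: "real \<Rightarrow> nat \<Rightarrow> nat \<Rightarrow> real" where
  "c_coef \<gamma> m n = (if \<gamma> = 2 then (if (m, n) = (1, 1) then 0 else 2) else 1)"

definition disc_frac_lap ::
  "real \<Rightarrow> real \<Rightarrow> real \<Rightarrow> real \<Rightarrow> real \<Rightarrow> real \<Rightarrow> nat
     \<Rightarrow> (real \<times> real \<Rightarrow> real) \<Rightarrow> real \<times> real \<Rightarrow> real" where
  "disc_frac_lap \<alpha> \<gamma> a1 b1 a2 b2 N u x =
    (let L = max (b1 - a1) (b2 - a2);
         h = L / real N;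
         \<xi> = (\<lambda>i j::nat. (real i * h, real j * h));
         I = (\<lambda>i j::nat. cbox (real i * h, real j * h) (real (i + 1) * h, real (j + 1) * h));
         D1 = {0<..<L} \<times> {0<..<L};
         D2 = ({0..} \<times> {0..}) - D1;
         \<psi> = psi_g \<gamma> u x;
         \<omega> = omega_g \<alpha> \<gamma>
     in - c_const 2 \<alpha> *
        ( 1/4 * (c_coef \<gamma> 1 0 * \<psi> (\<xi> 1 0) + c_coef \<gamma> 0 1 * \<psi> (\<xi> 0 1)
                 + c_coef \<gamma> 1 1 * \<psi> (\<xi> 1 1)) * integral (I 0 0) \<omega>
        + 1/4 * (\<Sum>(i, j) \<in> ({0..<N} \<times> {0..<N}) - {(0, 0)}.
                   (\<Sum>m\<in>{0, 1}. \<Sum>n\<in>{0, 1}. \<psi> (\<xi> (i + m) (j + n))) * integral (I i j) \<omega>)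
        - 4 * u x * integral D2 (\<lambda>\<xi>. norm \<xi> powr (-(2 + \<alpha>)))))"

end

theory Submission
  imports Defs
begin

text \<open>Write \<open>S(\<xi>)\<close> for the four-point second difference of \<open>u\<close> at \<open>x\<close>. Folding the plane onto the
  first quadrant turns the fractional Laplacian into a multiple of the integral of
  \<open>S(\<xi>) |\<xi>|\<close> to the power \<open>-(2 + \<alpha>)\<close>, and the part outside the square of side \<open>L\<close> is reproduced
  exactly because \<open>u\<close> vanishes there. Inside the square the scheme is a trapezoidal rule for
  \<open>\<psi> = S / |\<xi>|\<^sup>2\<close> with the exactly integrated weight \<open>\<omega> = |\<xi>|\<close> to the power \<open>-\<alpha>\<close>. Split
  \<open>S = 2 A \<xi>\<^sub>1\<^sup>2 + 2 B \<xi>\<^sub>2\<^sup>2 + g\<close>, where \<open>A\<close> and \<open>B\<close> are the pure second derivatives of \<open>u\<close> at \<open>x\<close>. The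
  quadratic part makes no error at all, by symmetry under exchange of the coordinates. The
  remainder \<open>g\<close> vanishes to order \<open>2 + \<alpha> + \<epsilon>\<close>, hence \<open>\<phi> = g / |\<xi>|\<^sup>2\<close> has order \<open>\<alpha> + \<epsilon>\<close>, each
  derivative costs one power of \<open>|\<xi>|\<close>, and a cell at distance \<open>r\<close> contributes at most a constant times
  \<open>h\<^sup>4\<close> times \<open>r\<close> to the power \<open>\<epsilon> - 2\<close>. This is integrable at the origin, so the sum is of order \<open>h\<^sup>2\<close>.\<close>

section \<open>Planar Lebesgue integrals\<close>

text \<open>Two effects meet in a cell at distance r. The interpolation error of
  \<open>\<phi>\<close> has size h^2 r^(alpha + eps - 2) and is multiplied by the weight r^(-alpha).
  The centred bilinear part of \<open>\<phi>\<close> has size h r^(alpha + eps - 1) but mean zero,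
  so it is felt only through the variation h r^(-alpha - 1) of the weight. Both products are h^2
  r^(eps - 2), and the cell area supplies the other h^2. In the cell at the origin these derivative
  bounds blow up; there the size h^(alpha + eps) of \<open>\<phi>\<close> times the mass h^(2 -
  alpha) of the weight already gives h^(2 + eps). The constant must not depend on x. The order of
  vanishing of g is controlled by global Hoelder constants, whereas A and B vary with x and drop out
  together with the quadratic part. That cancellation rests on the weights 2, 2, 0 of the origin
  cell: they keep the rule symmetric in the coordinates and of total weight one without sampling the
  origin.\<close>

lemma integrable_prod_mult:
  fixes f g :: "real \<Rightarrow> real"
  assumes "integrable lborel f" "integrable lborel g"
  shows "integrable lborel (\<lambda>z. f (fst z) * g (snd z))"
    and "integral\<^sup>L lborel (\<lambda>z. f (fst z) * g (snd z)) = integral\<^sup>L lborel f * integral\<^sup>L lborel g"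
proof -
  have mf [measurable]: "f \<in> borel_measurable borel" "g \<in> borel_measurable borel"
    using assms by auto
  have int: "integrable (lborel \<Otimes>\<^sub>M lborel) (\<lambda>z. f (fst z) * g (snd z))"
  proof (rule lborel_pair.Fubini_integrable)
    show "integrable lborel (\<lambda>x. \<integral>y. norm (f (fst (x, y)) * g (snd (x, y))) \<partial>lborel)"
      using assms by (simp add: abs_mult)
    show "AE x in lborel. integrable lborel (\<lambda>y. f (fst (x, y)) * g (snd (x, y)))"
      using assms by simp
  qed measurable
  then show "integrable lborel (\<lambda>z. f (fst z) * g (snd z))"
    by (simp add: lborel_prod)
  show "integral\<^sup>L lborel (\<lambda>z. f (fst z) * g (snd z)) = integral\<^sup>L lborel f * integral\<^sup>L lborel g"
    using lborel_pair.integral_fst'[OF int] by (simp add: lborel_prod)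
qed

lemma AE_lborel_fst_neq: "AE z in (lborel :: (real \<times> real) measure). fst z \<noteq> c"
  and AE_lborel_snd_neq: "AE z in (lborel :: (real \<times> real) measure). snd z \<noteq> c"
proof -
  have "{c} \<times> UNIV \<in> null_sets (lborel \<Otimes>\<^sub>M (lborel :: real measure))"
    "UNIV \<times> {c} \<in> null_sets ((lborel :: real measure) \<Otimes>\<^sub>M lborel)"
    by (auto simp: null_sets_def lborel.emeasure_pair_measure_Times simp del: emeasure_lborel_UNIV)
  then have "AE z in (lborel :: (real \<times> real) measure). z \<notin> {c} \<times> UNIV"
    "AE z in (lborel :: (real \<times> real) measure). z \<notin> UNIV \<times> {c}"
    using AE_not_in by (simp_all add: lborel_prod)
  then show "AE z in (lborel :: (real \<times> real) measure). fst z \<noteq> c"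
    "AE z in (lborel :: (real \<times> real) measure). snd z \<noteq> c"
    by (auto elim!: eventually_mono simp: mem_Times_iff)
qed

text \<open>The determinant is a product of signs, so the measure is preserved. One form serves two
  purposes: with a = b = 0 the reflections of the quadrant, with s = t = 1 the translation that
  moves x to the origin.\<close>

lemma lborel_distr_affine_sign:
  assumes "\<bar>s\<bar> = 1" "\<bar>t\<bar> = 1"
  shows "distr lborel borel (\<lambda>z. (a + s * fst z, b + t * snd z)) = (lborel :: (real \<times> real) measure)"
proof -
  define c :: "real \<times> real \<Rightarrow> real" where "c j = (if j = (1, 0) then s else t)" for j
  have ne: "c j \<noteq> 0" for j
    using assms by (auto simp: c_def)
  have B: "(Basis :: (real \<times> real) set) = {(1, 0), (0, 1)}"
    by (auto simp: Basis_prod_def)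
  have "(\<lambda>z. (a, b) + (\<Sum>j\<in>Basis. (c j * (z \<bullet> j)) *\<^sub>R j)) = (\<lambda>z. (a + s * fst z, b + t * snd z))"
    by (auto simp: B c_def fun_eq_iff)
  moreover have "(\<Prod>j\<in>(Basis :: (real \<times> real) set). \<bar>c j\<bar>) = 1"
    using assms by (simp add: B c_def)
  ultimately show ?thesis
    using lborel_affine_euclidean[where c = c and t = "(a, b)"] ne
    by (simp add: density_1)
qed

lemma lborel_pair_affine_sign:
  fixes f :: "real \<times> real \<Rightarrow> real"
  assumes "\<bar>s\<bar> = 1" "\<bar>t\<bar> = 1"
  shows "f \<in> borel_measurable borel \<Longrightarrow>
      integral\<^sup>L lborel (\<lambda>z. f (a + s * fst z, b + t * snd z)) = integral\<^sup>L lborel f"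
    and "integrable lborel f \<Longrightarrow> integrable lborel (\<lambda>z. f (a + s * fst z, b + t * snd z))"
proof -
  have m: "(\<lambda>z. (a + s * fst z, b + t * snd z)) \<in> (lborel :: (real \<times> real) measure) \<rightarrow>\<^sub>M borel"
    by (simp, intro borel_measurable_continuous_onI continuous_intros)
  show "integral\<^sup>L lborel (\<lambda>z. f (a + s * fst z, b + t * snd z)) = integral\<^sup>L lborel f"
    if "f \<in> borel_measurable borel"
    using integral_distr[OF m that] by (simp add: lborel_distr_affine_sign[OF assms])
  show "integrable lborel (\<lambda>z. f (a + s * fst z, b + t * snd z))" if "integrable lborel f"
    using integrable_distr[OF m, of f] that by (simp add: lborel_distr_affine_sign[OF assms])
qed

lemma lborel_pair_swap:
  fixes f :: "real \<times> real \<Rightarrow> real"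
  assumes "f \<in> borel_measurable borel"
  shows "integral\<^sup>L lborel (\<lambda>z. f (snd z, fst z)) = integral\<^sup>L lborel f"
  using lborel_pair.integral_product_swap[of f] assms
  by (simp add: lborel_prod borel_prod case_prod_beta')

text \<open>The plane is, up to the coordinate axes, the disjoint union of the four reflections of the
  open quadrant.\<close>

lemma integral_fold_quadrant:
  fixes f :: "real \<times> real \<Rightarrow> real"
  assumes "integrable lborel f"
  shows "integral\<^sup>L lborel f = (LINT z:{0<..} \<times> {0<..}|lborel.
      f (fst z, snd z) + f (fst z, - snd z) + f (- fst z, snd z) + f (- fst z, - snd z))"
proof -
  let ?Q = "{0<..} \<times> {0<..} :: (real \<times> real) set"
  have oQ: "open ?Q" by (intro open_Times) auto
  have mQ [measurable]: "?Q \<in> sets borel" using oQ by (rule borel_open)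
  have fm [measurable]: "f \<in> borel_measurable borel" using assms by auto
  define F where "F s t z = indicator ?Q (s * fst z, t * snd z) * f z" for s t :: real and z
  have iF: "integrable lborel (F s t)" if "\<bar>s\<bar> = 1" "\<bar>t\<bar> = 1" for s t
  proof -
    have m: "(\<lambda>z. (s * fst z, t * snd z)) \<in> (borel :: (real \<times> real) measure) \<rightarrow>\<^sub>M borel"
      by (intro borel_measurable_continuous_onI continuous_intros)
    have [measurable]: "(\<lambda>z. indicator ?Q (s * fst z, t * snd z) :: real) \<in> borel_measurable borel"
      using measurable_compose[OF m borel_measurable_indicator[OF mQ]] by simp
    show ?thesis
      unfolding F_def
      by (rule Bochner_Integration.integrable_bound[OF assms])
         (measurable, auto intro!: AE_I2 simp: indicator_def)
  qed
  have FT: "integral\<^sup>L lborel (F s t) = (LINT z:?Q|lborel. f (s * fst z, t * snd z))"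
    and IT: "set_integrable lborel ?Q (\<lambda>z. f (s * fst z, t * snd z))"
    if "\<bar>s\<bar> = 1" "\<bar>t\<bar> = 1" for s t
  proof -
    \<comment> \<open>\<open>F s t\<close> is f cut down to the open quadrant with signs (s, t). A
      reflection is its own inverse, so composing with it carries the cut-off back to
      \<open>?Q\<close>.\<close>
    have "s * s = 1" "t * t = 1" using that by (auto simp: abs_if split: if_splits)
    then have eq: "F s t (0 + s * fst z, 0 + t * snd z) = indicator ?Q z *\<^sub>R f (s * fst z, t * snd z)" for z
      unfolding F_def by (simp add: mult.assoc[symmetric])
    show "integral\<^sup>L lborel (F s t) = (LINT z:?Q|lborel. f (s * fst z, t * snd z))"
      using lborel_pair_affine_sign(1)[OF that, of "F s t" 0 0] iF[OF that]
      unfolding eq set_lebesgue_integral_def by auto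
    show "set_integrable lborel ?Q (\<lambda>z. f (s * fst z, t * snd z))"
      using lborel_pair_affine_sign(2)[OF that, of "F s t" 0 0] iF[OF that]
      unfolding eq set_integrable_def by auto
  qed
  have "integral\<^sup>L lborel f = integral\<^sup>L lborel (\<lambda>z. F 1 1 z + F 1 (-1) z + F (-1) 1 z + F (-1) (-1) z)"
  proof (rule integral_cong_AE)
    show "AE z in lborel. f z = F 1 1 z + F 1 (- 1) z + F (- 1) 1 z + F (- 1) (- 1) z"
      using AE_lborel_fst_neq[of 0] AE_lborel_snd_neq[of 0]
      by eventually_elim (auto simp: F_def indicator_def mem_Times_iff)
    show "f \<in> borel_measurable lborel" by simp
    show "(\<lambda>z. F 1 1 z + F 1 (-1) z + F (-1) 1 z + F (-1) (-1) z) \<in> borel_measurable lborel"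
      using iF by (intro borel_measurable_add) auto
  qed
  also have "\<dots> = integral\<^sup>L lborel (F 1 1) + integral\<^sup>L lborel (F 1 (-1))
      + integral\<^sup>L lborel (F (-1) 1) + integral\<^sup>L lborel (F (-1) (-1))"
    by (simp add: iF)
  also have "\<dots> = (LINT z:?Q|lborel.
      f (fst z, snd z) + f (fst z, - snd z) + f (- fst z, snd z) + f (- fst z, - snd z))"
    using IT[of 1 1] IT[of 1 "-1"] IT[of "-1" 1] IT[of "-1" "-1"]
    by (simp add: FT set_integral_add)
  finally show ?thesis .
qed

section \<open>Integrability of powers of the norm near the origin and at infinity\<close>

lemma set_integrable_Icc_powr:
  fixes a c :: real
  assumes "a > -1" "c \<ge> 0"
  shows "set_integrable lborel {0..c} (\<lambda>t. t powr a)"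
    and "(LINT t:{0..c}|lborel. t powr a) = c powr (a + 1) / (a + 1)"
proof -
  have "(\<lambda>t. t powr a) integrable_on {0..c}"
    by (rule integrable_on_powr_from_0[OF assms])
  then have "(\<lambda>t. t powr a) absolutely_integrable_on {0..c}"
    by (subst absolutely_integrable_on_iff_nonneg) auto
  then show *: "set_integrable lborel {0..c} (\<lambda>t. t powr a)"
    unfolding set_integrable_def by (subst (asm) integrable_completion) auto
  show "(LINT t:{0..c}|lborel. t powr a) = c powr (a + 1) / (a + 1)"
    using set_borel_integral_eq_integral(2)[OF *] has_integral_powr_from_0[OF assms]
    by (simp add: integral_unique)
qed

text \<open>The tail x^(-b) on [1, oo) is pulled back along 1 + t and along 1 - t; on each half line
  one of the two pullbacks equals the integrand, so their sum dominates it.\<close>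

lemma integrable_one_plus_abs_powr:
  fixes b :: real
  assumes "b > 1"
  shows "integrable lborel (\<lambda>t. (1 + \<bar>t\<bar>) powr - b)"
proof -
  have "((\<lambda>x. x powr - b) has_integral - (1 powr (- b + 1)) / (- b + 1)) {1..}"
    by (rule has_integral_powr_to_inf) (use assms in auto)
  then have "(\<lambda>x. x powr - b) absolutely_integrable_on {1..}"
    by (subst absolutely_integrable_on_iff_nonneg) (auto simp: integrable_on_def)
  then have "integrable lborel (\<lambda>x. indicator {1..} x *\<^sub>R x powr - b)"
    unfolding set_integrable_def by (subst (asm) integrable_completion) auto
  then have i: "integrable lborel (\<lambda>x. indicator {1..} (1 + s * x) *\<^sub>R (1 + s * x) powr - b)"
    if "s \<noteq> 0" for s
    using lborel_integrable_real_affine[OF _ that, of _ 1] by blast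
  show ?thesis
    by (rule Bochner_Integration.integrable_bound[OF Bochner_Integration.integrable_add[OF i[of 1] i[of "-1"]]])
       (auto simp: indicator_def)
qed

lemma norm_pair: "norm (z :: real \<times> real) = sqrt ((fst z)\<^sup>2 + (snd z)\<^sup>2)"
  by (simp add: norm_prod_def)

lemma norm_pair_sq: "(norm (z :: real \<times> real))\<^sup>2 = (fst z)\<^sup>2 + (snd z)\<^sup>2"
  by (simp add: norm_prod_def)

lemma abs_fst_le_norm: "\<bar>fst (z :: real \<times> real)\<bar> \<le> norm z"
  and abs_snd_le_norm: "\<bar>snd (z :: real \<times> real)\<bar> \<le> norm z"
  unfolding norm_pair by (auto simp: real_le_rsqrt)

lemma norm_pair_mono:
  fixes w z :: "real \<times> real"
  assumes "\<bar>fst w\<bar> \<le> \<bar>fst z\<bar>" "\<bar>snd w\<bar> \<le> \<bar>snd z\<bar>"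
  shows "norm w \<le> norm z"
  using assms unfolding norm_pair by (intro real_sqrt_le_mono add_mono) (auto simp: abs_le_square_iff)

text \<open>The singularity is dominated by a product of one-dimensional ones because
  \<open>|z|\<^sup>2 \<ge> |fst z| |snd z|\<close>.\<close>

lemma set_integrable_norm_powr_square:
  assumes "0 < \<alpha>" "\<alpha> < 2" "c \<ge> 0"
  shows "set_integrable lborel ({0..c} \<times> {0..c}) (\<lambda>z :: real \<times> real. norm z powr - \<alpha>)"
    and "(LINT z:{0..c} \<times> {0..c}|lborel. norm (z :: real \<times> real) powr - \<alpha>)
        \<le> (c powr (1 - \<alpha> / 2) / (1 - \<alpha> / 2))\<^sup>2"
proof -
  define p where "p t = indicator {0..c} t *\<^sub>R t powr (- \<alpha> / 2)" for t :: real
  have ip: "integrable lborel p" and vp: "integral\<^sup>L lborel p = c powr (1 - \<alpha> / 2) / (1 - \<alpha> / 2)"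
    using set_integrable_Icc_powr[of "- \<alpha> / 2" c] assms
    unfolding p_def set_integrable_def set_lebesgue_integral_def by (auto simp: algebra_simps)
  note ipp = integrable_prod_mult[OF ip ip]
  have le: "indicator ({0..c} \<times> {0..c}) z * norm z powr - \<alpha> \<le> p (fst z) * p (snd z)"
    if "fst z \<noteq> 0" "snd z \<noteq> 0" for z :: "real \<times> real"
  proof (cases "z \<in> {0..c} \<times> {0..c}")
    case True
    then have pos: "0 < fst z" "0 < snd z"
      using that by (auto simp: mem_Times_iff)
    have "fst z * snd z \<le> norm z * norm z"
      using abs_fst_le_norm[of z] abs_snd_le_norm[of z] pos by (intro mult_mono) auto
    then have "(norm z * norm z) powr (- \<alpha> / 2) \<le> (fst z * snd z) powr (- \<alpha> / 2)"
      using pos assms by (intro powr_mono2') auto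
    moreover have "(norm z * norm z) powr (- \<alpha> / 2) = norm z powr - \<alpha>"
      by (simp add: powr_mult powr_add[symmetric])
    ultimately show ?thesis
      using True pos by (simp add: p_def powr_mult mem_Times_iff)
  qed (auto simp: p_def)
  have AEle: "AE z in lborel. indicator ({0..c} \<times> {0..c}) z * norm (z :: real \<times> real) powr - \<alpha> \<le> p (fst z) * p (snd z)"
    using AE_lborel_fst_neq[of 0] AE_lborel_snd_neq[of 0] by eventually_elim (rule le)
  have [measurable]: "{0..c} \<times> {0..c} \<in> sets (borel :: (real \<times> real) measure)"
    by (intro borel_closed closed_Times) auto
  have int: "integrable lborel (\<lambda>z :: real \<times> real. indicator ({0..c} \<times> {0..c}) z * norm z powr - \<alpha>)"
    by (rule Bochner_Integration.integrable_bound[OF ipp(1)])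
       (use AEle in \<open>auto elim!: eventually_mono\<close>)
  then show "set_integrable lborel ({0..c} \<times> {0..c}) (\<lambda>z :: real \<times> real. norm z powr - \<alpha>)"
    by (simp add: set_integrable_def)
  show "(LINT z:{0..c} \<times> {0..c}|lborel. norm (z :: real \<times> real) powr - \<alpha>)
        \<le> (c powr (1 - \<alpha> / 2) / (1 - \<alpha> / 2))\<^sup>2"
    using integral_mono_AE[OF int ipp(1) AEle] by (simp add: set_lebesgue_integral_def ipp(2) vp power2_eq_square)
qed

text \<open>Again a product of one-dimensional functions dominates. The exponent 2 + alpha is split
  evenly into two exponents 1 + alpha/2, each above 1, by (1 + |x|)(1 + |y|) <= (1 + |z|)^2. Away
  from the origin 1 + |z| is at most (1 + 1/e) |z|, which is where K comes from.\<close>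

lemma set_integrable_norm_powr_outside:
  assumes "0 < \<alpha>" "0 < e"
  shows "set_integrable lborel {z. e \<le> norm z} (\<lambda>z :: real \<times> real. norm z powr - (2 + \<alpha>))"
proof -
  define p where "p t = (1 + \<bar>t\<bar>) powr - (1 + \<alpha> / 2)" for t :: real
  define K where "K = (1 + 1 / e) powr (2 + \<alpha>)"
  have ip: "integrable lborel p"
    using integrable_one_plus_abs_powr[of "1 + \<alpha> / 2"] assms unfolding p_def by simp
  have le: "norm z powr - (2 + \<alpha>) \<le> K * (p (fst z) * p (snd z))" if "e \<le> norm z" for z :: "real \<times> real"
  proof -
    have r: "norm z > 0" using that assms by linarith
    have "1 + norm z \<le> (1 + 1 / e) * norm z"
      using that assms by (simp add: field_simps)
    moreover have "(1 + \<bar>fst z\<bar>) * (1 + \<bar>snd z\<bar>) \<le> (1 + norm z) * (1 + norm z)"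
      using abs_fst_le_norm[of z] abs_snd_le_norm[of z] by (intro mult_mono) auto
    moreover have "(1 + norm z) * (1 + norm z) \<le> ((1 + 1 / e) * norm z) * ((1 + 1 / e) * norm z)"
      by (intro mult_mono calculation) (use assms in auto)
    ultimately have "(((1 + 1 / e) * norm z) * ((1 + 1 / e) * norm z)) powr - (1 + \<alpha> / 2)
        \<le> ((1 + \<bar>fst z\<bar>) * (1 + \<bar>snd z\<bar>)) powr - (1 + \<alpha> / 2)"
      using assms by (intro powr_mono2') (auto intro!: mult_pos_pos add_pos_nonneg)
    moreover have "(((1 + 1 / e) * norm z) * ((1 + 1 / e) * norm z)) powr - (1 + \<alpha> / 2)
        = ((1 + 1 / e) * norm z) powr - (2 + \<alpha>)"
      unfolding powr_mult[of "(1 + 1 / e) * norm z"] powr_add[symmetric]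
      by (intro arg_cong[of _ _ "\<lambda>p. _ powr p"]) simp
    moreover have "((1 + 1 / e) * norm z) powr - (2 + \<alpha>) = norm z powr - (2 + \<alpha>) / K"
      using powr_minus_divide[of "1 + 1 / e" "2 + \<alpha>"] unfolding K_def[symmetric]
      by (simp only: powr_mult) simp
    moreover have "((1 + \<bar>fst z\<bar>) * (1 + \<bar>snd z\<bar>)) powr - (1 + \<alpha> / 2) = p (fst z) * p (snd z)"
      unfolding p_def by (rule powr_mult)
    moreover have "0 < 1 + 1 / e" using assms by (simp add: add_pos_pos)
    ultimately have "norm z powr - (2 + \<alpha>) / K \<le> p (fst z) * p (snd z)" by metis
    moreover have "K > 0" using \<open>0 < 1 + 1 / e\<close> unfolding K_def by simp
    ultimately show ?thesis by (simp add: divide_le_eq mult.commute)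
  qed
  have [measurable]: "{z :: real \<times> real. e \<le> norm z} \<in> sets borel"
    by (intro borel_closed closed_Collect_le) (auto intro!: continuous_intros)
  have "integrable lborel (\<lambda>z. K * (p (fst z) * p (snd z)))"
    using integrable_prod_mult(1)[OF ip ip] by simp
  then show ?thesis
    unfolding set_integrable_def
    by (rule Bochner_Integration.integrable_bound)
       (use le in \<open>auto intro!: AE_I2 order_trans[OF _ le] simp: indicator_def p_def K_def\<close>)
qed

section \<open>Weighted trapezoidal rule on one cell\<close>

lemma deriv_bound_from_zero:
  fixes F F' :: "real \<Rightarrow> real"
  assumes "\<And>t. (F has_real_derivative F' t) (at t)"
    and "\<And>t. \<bar>t\<bar> \<le> \<bar>x\<bar> \<Longrightarrow> \<bar>F' t\<bar> \<le> B"
  shows "\<bar>F x - F 0\<bar> \<le> B * \<bar>x\<bar>"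
proof -
  have "norm (F x - F 0) \<le> B * norm (x - 0)"
    by (rule field_differentiable_bound[of "{-\<bar>x\<bar>..\<bar>x\<bar>}"])
       (use assms in \<open>auto intro: has_field_derivative_at_within\<close>)
  then show ?thesis by simp
qed

text \<open>By the mean value theorem the slope of the chord over the whole interval and the slope
  from a to a + s h are both values of \<open>f1\<close>. The error is s h times the difference of
  these two values, which is at most M h. The constant is not the sharp 1/8.\<close>

lemma linear_interpolation_error:
  fixes f f1 f2 :: "real \<Rightarrow> real"
  assumes f1: "\<And>t. t \<in> {a..a+h} \<Longrightarrow> (f has_real_derivative f1 t) (at t)"
    and f2: "\<And>t. t \<in> {a..a+h} \<Longrightarrow> (f1 has_real_derivative f2 t) (at t)"
    and M: "\<And>t. t \<in> {a..a+h} \<Longrightarrow> \<bar>f2 t\<bar> \<le> M"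
    and s: "0 \<le> s" "s \<le> 1" and h: "0 < h"
  shows "\<bar>f (a + s * h) - ((1 - s) * f a + s * f (a + h))\<bar> \<le> M * h\<^sup>2"
proof -
  have sh: "s * h \<le> h" "0 \<le> s * h" using s h by auto
  obtain c where c: "a < c" "c < a + h" "f (a + h) - f a = h * f1 c"
    using MVT2[of a "a + h" f f1] f1 h by auto
  obtain d where d: "a \<le> d" "d \<le> a + s * h" "f (a + s * h) - f a = s * h * f1 d"
  proof (cases "s * h = 0")
    case True
    then show ?thesis using that[of a] by (metis add_0_right diff_self mult_zero_left order_refl)
  next
    case False
    then have "a < a + s * h" using sh by linarith
    moreover have "(f has_real_derivative f1 t) (at t)" if "a \<le> t" "t \<le> a + s * h" for t
      using that sh by (intro f1) auto
    ultimately obtain d where "a < d" "d < a + s * h" "f (a + s * h) - f a = (a + s * h - a) * f1 d"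
      using MVT2[of a "a + s * h" f f1] by blast
    then show ?thesis using that[of d] by simp
  qed
  have "d \<le> a + h" using d(2) sh(1) by linarith
  then have dI: "d \<in> {a..a+h}" and cI: "c \<in> {a..a+h}" using c d by auto
  have "\<bar>f1 d - f1 c\<bar> \<le> M * \<bar>d - c\<bar>"
    using field_differentiable_bound[of "{a..a+h}" f1 f2 M d c] f2 M cI dI
    by (auto intro: has_field_derivative_at_within)
  also have "\<dots> \<le> M * h"
    using dI cI M[OF cI] by (intro mult_left_mono) auto
  finally have *: "\<bar>f1 d - f1 c\<bar> \<le> M * h" .
  have "f (a + s * h) - ((1 - s) * f a + s * f (a + h)) = (f (a + s * h) - f a) - s * (f (a + h) - f a)"
    by (simp add: algebra_simps)
  also have "\<dots> = s * h * (f1 d - f1 c)" unfolding c d by (simp add: algebra_simps)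
  finally have "\<bar>f (a + s * h) - ((1 - s) * f a + s * f (a + h))\<bar> = s * h * \<bar>f1 d - f1 c\<bar>"
    using sh s h by (simp add: abs_mult)
  also have "\<dots> \<le> h * (M * h)"
    using sh * h by (intro mult_mono) auto
  finally show ?thesis by (simp add: power2_eq_square mult.left_commute)
qed

lemma derivative_increment_bound:
  fixes f f1 :: "real \<Rightarrow> real"
  assumes "\<And>t. t \<in> {a..a+h} \<Longrightarrow> (f has_real_derivative f1 t) (at t)"
    and "\<And>t. t \<in> {a..a+h} \<Longrightarrow> \<bar>f1 t\<bar> \<le> M" and "0 < h"
  shows "\<bar>f (a + h) - f a\<bar> \<le> M * h"
  using field_differentiable_bound[of "{a..a+h}" f f1 M "a+h" a] assms
  by (auto intro: has_field_derivative_at_within)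

text \<open>Reflection in the midpoint, x to 2 a + h - x, preserves the interval and reverses the
  sign of the integrand.\<close>

lemma integral_centered_Icc:
  fixes a h :: real
  assumes "0 < h"
  shows "integrable lborel (\<lambda>x. indicator {a..a+h} x * (x - a - h / 2))"
    and "integral\<^sup>L lborel (\<lambda>x. indicator {a..a+h} x * (x - a - h / 2)) = 0"
proof -
  let ?p = "\<lambda>x. indicator {a..a+h} x * (x - a - h / 2)"
  have "set_integrable lborel {a..a+h} (\<lambda>x. x - a - h / 2)"
    unfolding set_integrable_def by (rule borel_integrable_compact) (auto intro!: continuous_intros)
  then show "integrable lborel ?p"
    by (simp add: set_integrable_def)
  have "integral\<^sup>L lborel ?p = \<bar>- 1\<bar> *\<^sub>R integral\<^sup>L lborel (\<lambda>x. ?p ((2 * a + h) + (- 1) * x))"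
    by (rule lborel_integral_real_affine) simp
  also have "(\<lambda>x. ?p ((2 * a + h) + (- 1) * x)) = (\<lambda>x. - ?p x)"
    by (auto simp: fun_eq_iff indicator_def algebra_simps)
  finally show "integral\<^sup>L lborel ?p = 0" by simp
qed

lemma integral_bilinear_centered:
  fixes a b h P Q R :: real
  assumes "0 < h"
  shows "set_integrable lborel ({a..a+h} \<times> {b..b+h})
      (\<lambda>z. P * (fst z - a - h / 2) + Q * (snd z - b - h / 2) + R * ((fst z - a - h / 2) * (snd z - b - h / 2)))" (is ?I)
    and "(LINT z:{a..a+h} \<times> {b..b+h}|lborel.
      P * (fst z - a - h / 2) + Q * (snd z - b - h / 2) + R * ((fst z - a - h / 2) * (snd z - b - h / 2))) = 0" (is ?E)
    and "set_integrable lborel ({a..a+h} \<times> {b..b+h}) (\<lambda>z. 1 :: real)" (is ?J)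
    and "(LINT z:{a..a+h} \<times> {b..b+h}|lborel. 1 :: real) = h\<^sup>2" (is ?K)
proof -
  let ?c = "\<lambda>a x. indicator {a..a+h} x * (x - a - h / 2) :: real"
  let ?o = "\<lambda>a x. indicator {a..a+h} x :: real"
  have io: "integrable lborel (?o a)" "integral\<^sup>L lborel (?o a) = h" for a
    using assms by simp_all
  note ic = integral_centered_Icc[OF assms]
  have eq: "indicator ({a..a+h} \<times> {b..b+h}) z *\<^sub>R
      (P * (fst z - a - h / 2) + Q * (snd z - b - h / 2) + R * ((fst z - a - h / 2) * (snd z - b - h / 2)))
    = P * (?c a (fst z) * ?o b (snd z)) + Q * (?o a (fst z) * ?c b (snd z)) + R * (?c a (fst z) * ?c b (snd z))" for z
    by (auto simp: indicator_def mem_Times_iff)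
  have eq1: "indicator ({a..a+h} \<times> {b..b+h}) z *\<^sub>R 1 = ?o a (fst z) * ?o b (snd z)" for z
    by (auto simp: indicator_times)
  note I = integrable_prod_mult(1)[OF ic(1)[of a] io(1)[of b]] integrable_prod_mult(1)[OF io(1)[of a] ic(1)[of b]]
    integrable_prod_mult(1)[OF ic(1)[of a] ic(1)[of b]]
  note V = integrable_prod_mult(2)[OF ic(1)[of a] io(1)[of b]] integrable_prod_mult(2)[OF io(1)[of a] ic(1)[of b]]
    integrable_prod_mult(2)[OF ic(1)[of a] ic(1)[of b]]
  have lin: "integral\<^sup>L lborel (\<lambda>z. P * f1 z + Q * f2 z + R * f3 z)
      = P * integral\<^sup>L lborel f1 + Q * integral\<^sup>L lborel f2 + R * integral\<^sup>L lborel f3"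
    if "integrable lborel f1" "integrable lborel f2" "integrable lborel f3" for f1 f2 f3 :: "real \<times> real \<Rightarrow> real"
    using that by simp
  show ?I unfolding set_integrable_def eq
    by (intro Bochner_Integration.integrable_add Bochner_Integration.integrable_mult_right I)
  show ?E unfolding set_lebesgue_integral_def eq
    by (rule trans[OF lin[OF I]]) (simp only: V ic mult_zero_left mult_zero_right add_0_right)
  show ?J unfolding set_integrable_def eq1
    by (rule integrable_prod_mult(1)[OF io(1)[of a] io(1)[of b]])
  show ?K unfolding set_lebesgue_integral_def eq1
    by (subst integrable_prod_mult(2)[OF io(1)[of a] io(1)[of b]]) (simp only: io power2_eq_square)
qed

text \<open>Let m + L be the bilinear interpolant of the corner values, expanded about the centre of
  the cell. Its value at the centre is the corner mean m, and L has integral zero, so subtracting L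
  times the constant \<open>w0\<close> is free. Then (f - m) w - L w0 = (f - m - L) w + L (w - w0):
  the first term pays with second derivatives and the size of w, the second with first derivatives
  and the variation of w.\<close>

lemma weighted_cell_quadrature:
  fixes f fx fxx fy fyy w :: "real \<times> real \<Rightarrow> real" and a b h :: real
  defines "C \<equiv> {a..a+h} \<times> {b..b+h}"
  assumes h: "0 < h"
    and dx: "\<And>x y. (x, y) \<in> C \<Longrightarrow> ((\<lambda>t. f (t, y)) has_real_derivative fx (x, y)) (at x)"
    and dxx: "\<And>x y. (x, y) \<in> C \<Longrightarrow> ((\<lambda>t. fx (t, y)) has_real_derivative fxx (x, y)) (at x)"
    and dy: "\<And>x y. (x, y) \<in> C \<Longrightarrow> ((\<lambda>t. f (x, t)) has_real_derivative fy (x, y)) (at y)"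
    and dyy: "\<And>x y. (x, y) \<in> C \<Longrightarrow> ((\<lambda>t. fy (x, t)) has_real_derivative fyy (x, y)) (at y)"
    and M1: "\<And>z. z \<in> C \<Longrightarrow> \<bar>fx z\<bar> \<le> M1" "\<And>z. z \<in> C \<Longrightarrow> \<bar>fy z\<bar> \<le> M1"
    and M2: "\<And>z. z \<in> C \<Longrightarrow> \<bar>fxx z\<bar> \<le> M2" "\<And>z. z \<in> C \<Longrightarrow> \<bar>fyy z\<bar> \<le> M2"
    and w: "\<And>z. z \<in> C \<Longrightarrow> \<bar>w z - w0\<bar> \<le> W" "\<And>z. z \<in> C \<Longrightarrow> \<bar>w z\<bar> \<le> V"
    and int: "set_integrable lborel C (\<lambda>z. (f z - (f (a, b) + f (a, b + h) + f (a + h, b) + f (a + h, b + h)) / 4) * w z)"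
  shows "\<bar>LINT z:C|lborel. (f z - (f (a, b) + f (a, b + h) + f (a + h, b) + f (a + h, b + h)) / 4) * w z\<bar>
      \<le> (2 * M2 * h\<^sup>2 * V + 2 * M1 * h * W) * h\<^sup>2"
proof -
  define m where "m = (f (a, b) + f (a, b + h) + f (a + h, b) + f (a + h, b + h)) / 4"
  define P where "P = (f (a + h, b) + f (a + h, b + h) - f (a, b) - f (a, b + h)) / (2 * h)"
  define Q where "Q = (f (a, b + h) + f (a + h, b + h) - f (a, b) - f (a + h, b)) / (2 * h)"
  define R where "R = (f (a, b) + f (a + h, b + h) - f (a, b + h) - f (a + h, b)) / h\<^sup>2"
  define L where "L z = P * (fst z - a - h / 2) + Q * (snd z - b - h / 2)
      + R * ((fst z - a - h / 2) * (snd z - b - h / 2))" for z :: "real \<times> real"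
  have corner: "(a, b) \<in> C" using h by (simp add: C_def)
  have M0: "0 \<le> M1" "0 \<le> M2" "0 \<le> W" "0 \<le> V"
    using M1(1)[OF corner] M2(1)[OF corner] w[OF corner] by auto
  have ex: "\<bar>f (a + h, y) - f (a, y)\<bar> \<le> M1 * h" if "y \<in> {b..b+h}" for y
    using that h
    by (intro derivative_increment_bound[where f = "\<lambda>t. f (t, y)" and ?f1.0 = "\<lambda>t. fx (t, y)"] dx M1) (auto simp: C_def)
  have ey: "\<bar>f (x, b + h) - f (x, b)\<bar> \<le> M1 * h" if "x \<in> {a..a+h}" for x
    using that h
    by (intro derivative_increment_bound[where f = "\<lambda>t. f (x, t)" and ?f1.0 = "\<lambda>t. fy (x, t)"] dy M1) (auto simp: C_def)
  have main: "\<bar>f z - m - L z\<bar> \<le> 2 * M2 * h\<^sup>2 \<and> \<bar>L z\<bar> \<le> 2 * M1 * h" if z: "z \<in> C" for z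
  proof -
    define s t where "s = (fst z - a) / h" and "t = (snd z - b) / h"
    have st: "0 \<le> s" "s \<le> 1" "0 \<le> t" "t \<le> 1" and zeq: "z = (a + s * h, b + t * h)"
      using z h by (auto simp: s_def t_def C_def divide_simps prod_eq_iff)
    have sI: "a + s * h \<in> {a..a+h}" and tI: "b + t * h \<in> {b..b+h}"
      using z unfolding zeq C_def by auto
    have Leq: "L z = (s - 1/2) * (P * h) + (t - 1/2) * (Q * h) + (s - 1/2) * (t - 1/2) * (R * h\<^sup>2)"
      unfolding L_def zeq by (simp add: algebra_simps power2_eq_square)
    have PQR: "P * h = ((f (a + h, b) - f (a, b)) + (f (a + h, b + h) - f (a, b + h))) / 2"
      "Q * h = ((f (a, b + h) - f (a, b)) + (f (a + h, b + h) - f (a + h, b))) / 2"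
      "R * h\<^sup>2 = (f (a + h, b + h) - f (a + h, b)) - (f (a, b + h) - f (a, b))"
      using h by (simp_all add: P_def Q_def R_def)
    \<comment> \<open>Written in this form, m + L is linear interpolation in x along the two
      horizontal edges, followed by linear interpolation in y.\<close>
    have Leq2: "m + L z = (1 - t) * ((1 - s) * f (a, b) + s * f (a + h, b)) + t * ((1 - s) * f (a, b + h) + s * f (a + h, b + h))"
      unfolding Leq m_def PQR by (simp add: field_simps)
    have 1: "\<bar>f (a + s * h, b + t * h) - ((1 - t) * f (a + s * h, b) + t * f (a + s * h, b + h))\<bar> \<le> M2 * h\<^sup>2"
      using st h sI
      by (intro linear_interpolation_error[where f = "\<lambda>y. f (a + s * h, y)" and ?f1.0 = "\<lambda>y. fy (a + s * h, y)"
            and ?f2.0 = "\<lambda>y. fyy (a + s * h, y)"] dy dyy M2) (auto simp: C_def)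
    have 2: "\<bar>f (a + s * h, y) - ((1 - s) * f (a, y) + s * f (a + h, y))\<bar> \<le> M2 * h\<^sup>2" if "y \<in> {b..b+h}" for y
      using st h that
      by (intro linear_interpolation_error[where f = "\<lambda>x. f (x, y)" and ?f1.0 = "\<lambda>x. fx (x, y)"
            and ?f2.0 = "\<lambda>x. fxx (x, y)"] dx dxx M2) (auto simp: C_def)
    \<comment> \<open>Interpolating in y along the vertical line through z costs one
      \<open>M2\<close> term. Replacing its two end values by interpolation in x along the edges
      adds a convex combination of \<open>e0\<close> and \<open>e1\<close>, hence a second
      one.\<close>
    define e0 e1 where "e0 = f (a + s * h, b) - ((1 - s) * f (a, b) + s * f (a + h, b))"
      and "e1 = f (a + s * h, b + h) - ((1 - s) * f (a, b + h) + s * f (a + h, b + h))"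
    have "\<bar>e0\<bar> \<le> M2 * h\<^sup>2" "\<bar>e1\<bar> \<le> M2 * h\<^sup>2"
      unfolding e0_def e1_def using 2 h by auto
    then have "\<bar>(1 - t) * e0 + t * e1\<bar> \<le> (1 - t) * (M2 * h\<^sup>2) + t * (M2 * h\<^sup>2)"
      using st by (intro order_trans[OF abs_triangle_ineq] add_mono) (auto simp: abs_mult intro!: mult_left_mono)
    also have "\<dots> = M2 * h\<^sup>2" by (simp add: algebra_simps)
    finally have 3: "\<bar>(1 - t) * e0 + t * e1\<bar> \<le> M2 * h\<^sup>2" .
    have "f z - m - L z = (f (a + s * h, b + t * h) - ((1 - t) * f (a + s * h, b) + t * f (a + s * h, b + h)))
        + ((1 - t) * e0 + t * e1)"
      using Leq2 unfolding e0_def e1_def zeq by (simp add: algebra_simps)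
    then have A: "\<bar>f z - m - L z\<bar> \<le> 2 * M2 * h\<^sup>2"
      using 1 3 by linarith
    have Pb: "\<bar>P * h\<bar> \<le> M1 * h"
      unfolding PQR using ex[of b] ex[of "b + h"] h by auto
    have Qb: "\<bar>Q * h\<bar> \<le> M1 * h"
      unfolding PQR using ey[of a] ey[of "a + h"] h by auto
    \<comment> \<open>The mixed difference is read as the difference of two increments in y over
      opposite edges. First derivatives therefore bound it, and no mixed derivative appears.\<close>
    have Rb: "\<bar>R * h\<^sup>2\<bar> \<le> 2 * (M1 * h)"
      unfolding PQR using ey[of a] ey[of "a + h"] h by auto
    have half: "\<bar>s - 1/2\<bar> \<le> 1/2" "\<bar>t - 1/2\<bar> \<le> 1/2" using st by (auto simp: abs_if)
    have q: "\<bar>(s - 1/2) * (t - 1/2)\<bar> \<le> 1/2 * (1/2)"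
      unfolding abs_mult using half by (intro mult_mono) auto
    have "\<bar>L z\<bar> \<le> \<bar>(s - 1/2) * (P * h)\<bar> + \<bar>(t - 1/2) * (Q * h)\<bar> + \<bar>(s - 1/2) * (t - 1/2) * (R * h\<^sup>2)\<bar>"
      unfolding Leq by (rule order_trans[OF abs_triangle_ineq add_right_mono[OF abs_triangle_ineq]])
    also have "\<dots> \<le> 1/2 * (M1 * h) + 1/2 * (M1 * h) + 1/2 * (1/2) * (2 * (M1 * h))"
      unfolding abs_mult[of _ "P * h"] abs_mult[of _ "Q * h"] abs_mult[of _ "R * h\<^sup>2"]
      using half q Pb Qb Rb by (intro add_mono mult_mono) auto
    also have "\<dots> \<le> 2 * M1 * h" using M0 h by simp
    finally show ?thesis using A by simp
  qed
  note LI = integral_bilinear_centered[OF h, of a b, folded C_def]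
  have LI1: "set_integrable lborel C L" and LI2: "(LINT z:C|lborel. L z) = 0"
    using LI(1)[of P Q R] LI(2)[of P Q R] by (simp_all add: L_def[abs_def])
  have intm: "set_integrable lborel C (\<lambda>z. (f z - m) * w z)"
    using int unfolding m_def .
  have LI3: "set_integrable lborel C (\<lambda>z. L z * w0)"
    using LI1 by simp
  have "(LINT z:C|lborel. (f z - m) * w z) = (LINT z:C|lborel. (f z - m) * w z - L z * w0)"
    by (subst set_integral_diff(2)[OF intm LI3]) (simp add: LI2)
  moreover have "\<bar>LINT z:C|lborel. (f z - m) * w z - L z * w0\<bar>
      \<le> (LINT z:C|lborel. (2 * M2 * h\<^sup>2 * V + 2 * M1 * h * W) * 1)"
  proof -
    have "\<bar>LINT z:C|lborel. (f z - m) * w z - L z * w0\<bar> \<le> (LINT z:C|lborel. \<bar>(f z - m) * w z - L z * w0\<bar>)"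
      unfolding set_lebesgue_integral_def by (rule order_trans[OF integral_abs_bound]) (simp add: abs_mult)
    also have "\<dots> \<le> (LINT z:C|lborel. (2 * M2 * h\<^sup>2 * V + 2 * M1 * h * W) * 1)"
    proof (rule set_integral_mono)
      show "set_integrable lborel C (\<lambda>z. \<bar>(f z - m) * w z - L z * w0\<bar>)"
        by (intro set_integrable_abs set_integral_diff(1) intm LI3)
      show "set_integrable lborel C (\<lambda>z. (2 * M2 * h\<^sup>2 * V + 2 * M1 * h * W) * 1)"
        by (rule set_integrable_mult_right, rule LI(3))
      fix z assume z: "z \<in> C"
      have "(f z - m) * w z - L z * w0 = (f z - m - L z) * w z + L z * (w z - w0)"
        by (simp add: algebra_simps)
      then have "\<bar>(f z - m) * w z - L z * w0\<bar> \<le> \<bar>f z - m - L z\<bar> * \<bar>w z\<bar> + \<bar>L z\<bar> * \<bar>w z - w0\<bar>"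
        using abs_triangle_ineq[of "(f z - m - L z) * w z" "L z * (w z - w0)"] by (simp add: abs_mult)
      also have "\<dots> \<le> 2 * M2 * h\<^sup>2 * V + 2 * M1 * h * W"
        using main[OF z] w[OF z] M0 h by (intro add_mono mult_mono) auto
      finally show "\<bar>(f z - m) * w z - L z * w0\<bar> \<le> (2 * M2 * h\<^sup>2 * V + 2 * M1 * h * W) * 1" by simp
    qed
    finally show ?thesis .
  qed
  moreover have "(LINT z:C|lborel. (2 * M2 * h\<^sup>2 * V + 2 * M1 * h * W) * 1) = (2 * M2 * h\<^sup>2 * V + 2 * M1 * h * W) * h\<^sup>2"
    using LI(4) by (simp only: set_integral_mult_right)
  ultimately show ?thesis unfolding m_def by simp
qed

section \<open>Derivatives of a quotient by the squared norm along a coordinate line\<close>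

definition quot_d1 :: "(real \<Rightarrow> real) \<Rightarrow> (real \<Rightarrow> real) \<Rightarrow> real \<Rightarrow> real \<Rightarrow> real" where
  "quot_d1 G G1 c t = G1 t / (t\<^sup>2 + c\<^sup>2) - 2 * t * G t / (t\<^sup>2 + c\<^sup>2)\<^sup>2"

definition quot_d2 :: "(real \<Rightarrow> real) \<Rightarrow> (real \<Rightarrow> real) \<Rightarrow> (real \<Rightarrow> real) \<Rightarrow> real \<Rightarrow> real \<Rightarrow> real" where
  "quot_d2 G G1 G2 c t = G2 t / (t\<^sup>2 + c\<^sup>2) - 4 * t * G1 t / (t\<^sup>2 + c\<^sup>2)\<^sup>2
     + G t * (8 * t\<^sup>2 / (t\<^sup>2 + c\<^sup>2) ^ 3 - 2 / (t\<^sup>2 + c\<^sup>2)\<^sup>2)"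

lemma has_derivative_quot:
  assumes "(G has_real_derivative G1 t) (at t)" "(G1 has_real_derivative G2 t) (at t)"
    and "t\<^sup>2 + c\<^sup>2 \<noteq> 0"
  shows "((\<lambda>t. G t / (t\<^sup>2 + c\<^sup>2)) has_real_derivative quot_d1 G G1 c t) (at t)"
    and "(quot_d1 G G1 c has_real_derivative quot_d2 G G1 G2 c t) (at t)"
proof -
  define r where "r = t\<^sup>2 + c\<^sup>2"
  have r: "r \<noteq> 0" using assms(3) by (simp add: r_def)
  have dr: "((\<lambda>t. t\<^sup>2 + c\<^sup>2) has_real_derivative 2 * t) (at t)"
    by (auto intro!: derivative_eq_intros)
  have ne: "t\<^sup>2 + c\<^sup>2 \<noteq> 0" "(t\<^sup>2 + c\<^sup>2)\<^sup>2 \<noteq> 0" using assms(3) by simp_all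
  show "((\<lambda>t. G t / (t\<^sup>2 + c\<^sup>2)) has_real_derivative quot_d1 G G1 c t) (at t)"
    by (rule DERIV_cong[OF DERIV_divide[OF assms(1) dr ne(1)]])
       (unfold quot_d1_def r_def[symmetric], use r in \<open>simp add: field_simps power2_eq_square\<close>)
  have e: "quot_d1 G G1 c = (\<lambda>t. G1 t / (t\<^sup>2 + c\<^sup>2) - 2 * t * G t / (t\<^sup>2 + c\<^sup>2)\<^sup>2)"
    by (simp add: fun_eq_iff quot_d1_def)
  have "((\<lambda>t. G1 t / (t\<^sup>2 + c\<^sup>2)) has_real_derivative (G2 t * r - G1 t * (2 * t)) / (r * r)) (at t)"
    using DERIV_divide[OF assms(2) dr ne(1)] by (simp add: r_def)
  moreover have "((\<lambda>t. 2 * t * G t / (t\<^sup>2 + c\<^sup>2)\<^sup>2) has_real_derivative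
      ((2 * G t + 2 * t * G1 t) * r\<^sup>2 - 2 * t * G t * (4 * t * r)) / (r\<^sup>2 * r\<^sup>2)) (at t)"
  proof -
    have "((\<lambda>t. 2 * t) has_real_derivative 2) (at t)" by (auto intro!: derivative_eq_intros)
    from DERIV_mult[OF this assms(1)]
    have n: "((\<lambda>t. 2 * t * G t) has_real_derivative 2 * G t + 2 * t * G1 t) (at t)"
      by (simp add: algebra_simps)
    have "((\<lambda>t. (t\<^sup>2 + c\<^sup>2)\<^sup>2) has_real_derivative 4 * t * r) (at t)"
      using DERIV_power[OF dr, of 2] by (simp add: r_def algebra_simps)
    from DERIV_divide[OF n this ne(2)] show ?thesis by (simp add: r_def)
  qed
  ultimately have "(quot_d1 G G1 c has_real_derivative
      (G2 t * r - G1 t * (2 * t)) / (r * r) - ((2 * G t + 2 * t * G1 t) * r\<^sup>2 - 2 * t * G t * (4 * t * r)) / (r\<^sup>2 * r\<^sup>2)) (at t)"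
    unfolding e by (rule DERIV_diff)
  moreover have "(G2 t * r - G1 t * (2 * t)) / (r * r) - ((2 * G t + 2 * t * G1 t) * r\<^sup>2 - 2 * t * G t * (4 * t * r)) / (r\<^sup>2 * r\<^sup>2)
      = quot_d2 G G1 G2 c t"
    unfolding quot_d2_def r_def[symmetric] using r
    by (simp add: field_simps power2_eq_square power3_eq_cube)
  ultimately show "(quot_d1 G G1 c has_real_derivative quot_d2 G G1 G2 c t) (at t)" by simp
qed

lemma quot_bounds:
  fixes r :: real
  assumes r: "0 < r" "r\<^sup>2 = t\<^sup>2 + c\<^sup>2"
    and G: "\<bar>G t\<bar> \<le> 2 * K * r powr (\<sigma> + 2)" "\<bar>G1 t\<bar> \<le> K * r powr (\<sigma> + 1)" "\<bar>G2 t\<bar> \<le> K * r powr \<sigma>"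
  shows "\<bar>G t / (t\<^sup>2 + c\<^sup>2)\<bar> \<le> 2 * K * r powr \<sigma>"
    and "\<bar>quot_d1 G G1 c t\<bar> \<le> 5 * K * r powr (\<sigma> - 1)"
    and "\<bar>quot_d2 G G1 G2 c t\<bar> \<le> 25 * K * r powr (\<sigma> - 2)"
proof -
  \<comment> \<open>Taking out the lowest power turns all other powers into natural powers of r
    times y, so that the estimates become polynomial arithmetic.\<close>
  define y where "y = r powr (\<sigma> - 2)"
  have y: "r powr (\<sigma> + 2) = r ^ 4 * y" "r powr (\<sigma> + 1) = r ^ 3 * y" "r powr \<sigma> = r\<^sup>2 * y"
    "r powr (\<sigma> - 1) = r * y"
  proof -
    have "r powr (\<sigma> - 2 + real n) = r ^ n * y" for n
      using r(1) by (simp add: y_def powr_add powr_realpow)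
    from this[of 4] this[of 3] this[of 2] this[of 1]
    show "r powr (\<sigma> + 2) = r ^ 4 * y" "r powr (\<sigma> + 1) = r ^ 3 * y" "r powr \<sigma> = r\<^sup>2 * y"
      "r powr (\<sigma> - 1) = r * y" by (simp_all add: add.commute)
  qed
  have y0: "y \<ge> 0" by (simp add: y_def)
  have tr: "\<bar>t\<bar> \<le> r" by (rule power2_le_imp_le) (use r in auto)
  \<comment> \<open>The sign of K y is read off from the bound on \<open>G2 t\<close>, which
    dominates an absolute value.\<close>
  have K0: "0 \<le> K * y"
  proof -
    have "0 \<le> K * (r\<^sup>2 * y)" using order_trans[OF abs_ge_zero G(3)] y by simp
    then have "0 \<le> (K * y) * r\<^sup>2" by (simp add: algebra_simps)
    moreover have "0 < r\<^sup>2" using r(1) by simp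
    ultimately show ?thesis using mult_le_cancel_right_pos[of "r\<^sup>2" 0 "K * y"] by simp
  qed
  have g: "\<bar>G t\<bar> \<le> 2 * (K * y) * r ^ 4" "\<bar>G1 t\<bar> \<le> (K * y) * r ^ 3" "\<bar>G2 t\<bar> \<le> (K * y) * r\<^sup>2"
    using G unfolding y by (simp_all add: mult_ac)
  have G0: "\<bar>G t / (t\<^sup>2 + c\<^sup>2)\<bar> \<le> 2 * (K * y) * r\<^sup>2"
    unfolding r(2)[symmetric] using g(1) r(1)
    by (simp add: abs_divide divide_le_eq power2_eq_square power4_eq_xxxx mult_ac)
  then show "\<bar>G t / (t\<^sup>2 + c\<^sup>2)\<bar> \<le> 2 * K * r powr \<sigma>" by (simp add: y mult_ac)
  have a1: "\<bar>G1 t / r\<^sup>2\<bar> \<le> (K * y) * r"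
    using g(2) r(1) by (simp add: abs_divide divide_le_eq power2_eq_square power3_eq_cube mult_ac)
  have a2: "\<bar>2 * t * G t / (r\<^sup>2)\<^sup>2\<bar> \<le> 4 * (K * y) * r"
  proof -
    have "\<bar>2 * t * G t\<bar> \<le> 2 * r * (2 * (K * y) * r ^ 4)"
      unfolding abs_mult using g(1) tr r(1) by (intro mult_mono) auto
    then show ?thesis using r(1) by (simp add: abs_divide divide_le_eq power_mult[symmetric] power4_eq_xxxx mult_ac)
  qed
  show "\<bar>quot_d1 G G1 c t\<bar> \<le> 5 * K * r powr (\<sigma> - 1)"
    unfolding quot_d1_def r(2)[symmetric] y
    by (rule order_trans[OF abs_triangle_ineq4], rule order_trans[OF add_mono[OF a1 a2]]) (simp add: algebra_simps)
  have b1: "\<bar>G2 t / r\<^sup>2\<bar> \<le> K * y"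
    using g(3) r(1) by (simp add: abs_divide divide_le_eq)
  have b2: "\<bar>4 * t * G1 t / (r\<^sup>2)\<^sup>2\<bar> \<le> 4 * (K * y)"
  proof -
    have "\<bar>4 * t * G1 t\<bar> \<le> 4 * r * ((K * y) * r ^ 3)"
      unfolding abs_mult using g(2) tr r(1) by (intro mult_mono) auto
    then show ?thesis using r(1) by (simp add: abs_divide divide_le_eq power_mult[symmetric] power4_eq_xxxx power3_eq_cube mult_ac)
  qed
  have b3: "\<bar>8 * t\<^sup>2 / (r\<^sup>2) ^ 3 - 2 / (r\<^sup>2)\<^sup>2\<bar> \<le> 10 / r ^ 4"
  proof -
    have t2: "t\<^sup>2 \<le> r\<^sup>2" using r(2) by simp
    have "8 * t\<^sup>2 / (r\<^sup>2) ^ 3 \<le> 8 * r\<^sup>2 / (r\<^sup>2) ^ 3"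
      using t2 by (intro divide_right_mono) auto
    also have "\<dots> = 8 / r ^ 4" using r(1) by (simp add: field_simps power_mult[symmetric] flip: power_add)
    finally have "8 * t\<^sup>2 / (r\<^sup>2) ^ 3 \<le> 8 / r ^ 4" .
    moreover have "0 \<le> 8 * t\<^sup>2 / (r\<^sup>2) ^ 3" by simp
    moreover have "2 / (r\<^sup>2)\<^sup>2 = 2 / r ^ 4" by (simp add: power_mult[symmetric])
    moreover have "10 / r ^ 4 = 8 / r ^ 4 + 2 / r ^ 4" by (simp add: add_divide_distrib[symmetric])
    moreover have "0 \<le> 2 / r ^ 4" "0 \<le> 8 / r ^ 4" using r(1) by auto
    ultimately show ?thesis by linarith
  qed
  have b4: "\<bar>G t * (8 * t\<^sup>2 / (r\<^sup>2) ^ 3 - 2 / (r\<^sup>2)\<^sup>2)\<bar> \<le> 20 * (K * y)"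
  proof -
    have "\<bar>G t * (8 * t\<^sup>2 / (r\<^sup>2) ^ 3 - 2 / (r\<^sup>2)\<^sup>2)\<bar> \<le> (2 * (K * y) * r ^ 4) * (10 / r ^ 4)"
      unfolding abs_mult[of "G t"] using g(1) b3 K0 by (intro mult_mono) auto
    then show ?thesis using r(1) by simp
  qed
  show "\<bar>quot_d2 G G1 G2 c t\<bar> \<le> 25 * K * r powr (\<sigma> - 2)"
    unfolding quot_d2_def r(2)[symmetric] y_def[symmetric] 
    by (rule order_trans[OF abs_triangle_ineq], rule order_trans[OF add_mono[OF order_trans[OF abs_triangle_ineq4 add_mono[OF b1 b2]] b4]])
       (simp add: algebra_simps)
qed

section \<open>Second differences of Hoelder functions\<close>

text \<open>Kept free of the weight and of the subtracted centre value so that it applies to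
  derivatives of u as well: two differentiations in the same coordinate square the reflection signs
  away, and the second derivative of \<open>sum4 u x\<close> is \<open>sum4\<close> of the
  corresponding second derivative of u.\<close>

definition sum4 :: "(real \<times> real \<Rightarrow> real) \<Rightarrow> real \<times> real \<Rightarrow> real \<times> real \<Rightarrow> real" where
  "sum4 v x z = v (fst x + fst z, snd x + snd z) + v (fst x + fst z, snd x - snd z)
    + v (fst x - fst z, snd x + snd z) + v (fst x - fst z, snd x - snd z)"

lemma sum4_holder:
  assumes "\<And>p q. \<bar>v p - v q\<bar> \<le> C * dist p q powr s"
  shows "\<bar>sum4 v x z - 4 * v x\<bar> \<le> 4 * C * norm z powr s"
proof -
  have d: "dist (fst x + a, snd x + b) x = norm z" if "\<bar>a\<bar> = \<bar>fst z\<bar>" "\<bar>b\<bar> = \<bar>snd z\<bar>" for a b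
    using that by (auto simp: dist_norm minus_prod_def intro!: antisym norm_pair_mono)
  have "\<bar>v (fst x + a, snd x + b) - v x\<bar> \<le> C * norm z powr s" if "\<bar>a\<bar> = \<bar>fst z\<bar>" "\<bar>b\<bar> = \<bar>snd z\<bar>" for a b
    using assms[of "(fst x + a, snd x + b)" x] unfolding d[OF that] .
  from this[of "fst z" "snd z"] this[of "fst z" "- snd z"] this[of "- fst z" "snd z"] this[of "- fst z" "- snd z"]
  show ?thesis unfolding sum4_def by simp
qed

text \<open>Move from (x, y) first horizontally, then vertically. On each leg the derivative differs
  from its value at (x, y) by at most C r^s, and the leg has length at most r =
  \<open>norm (a, b)\<close>; the factor 2 counts the legs.\<close>

lemma first_order_taylor_holder:
  fixes v vx vy :: "real \<times> real \<Rightarrow> real"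
  assumes dx: "\<And>a b. ((\<lambda>t. v (t, b)) has_real_derivative vx (a, b)) (at a)"
    and dy: "\<And>a b. ((\<lambda>t. v (a, t)) has_real_derivative vy (a, b)) (at b)"
    and hx: "\<And>p q. \<bar>vx p - vx q\<bar> \<le> C * dist p q powr s"
    and hy: "\<And>p q. \<bar>vy p - vy q\<bar> \<le> C * dist p q powr s"
    and "0 < s" "0 \<le> C"
  shows "\<bar>v (x + a, y + b) - v (x, y) - a * vx (x, y) - b * vy (x, y)\<bar>
    \<le> 2 * C * norm (a, b) powr (1 + s)"
proof -
  let ?r = "norm (a, b)"
  have ab: "\<bar>a\<bar> \<le> ?r" "\<bar>b\<bar> \<le> ?r" using abs_fst_le_norm[of "(a, b)"] abs_snd_le_norm[of "(a, b)"] by auto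
  have nm: "C * dist p q powr s \<le> C * ?r powr s" if "dist p q \<le> ?r" for p q :: "real \<times> real"
    using that assms by (intro mult_left_mono powr_mono2) auto
  have sh: "((\<lambda>t. f (c + t)) has_real_derivative D) (at t)"
    if "(f has_real_derivative D) (at (c + t))" for f :: "real \<Rightarrow> real" and c t D
    using that DERIV_shift[of f D t c] by (simp add: add.commute)
  have 1: "((\<lambda>t. v (x + a, y + t) - t * vy (x, y)) has_real_derivative vy (x + a, y + t) - vy (x, y)) (at t)" for t
    by (rule derivative_eq_intros sh dy refl | simp)+
  have 2: "((\<lambda>t. v (x + t, y) - t * vx (x, y)) has_real_derivative vx (x + t, y) - vx (x, y)) (at t)" for t
    by (rule derivative_eq_intros sh[where f = "\<lambda>t. v (t, y)"] dx refl | simp)+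
  have "\<bar>vy (x + a, y + t) - vy (x, y)\<bar> \<le> C * ?r powr s" if "\<bar>t\<bar> \<le> \<bar>b\<bar>" for t
    using that by (intro order_trans[OF hy nm])
      (auto simp: dist_norm intro!: norm_pair_mono)
  from deriv_bound_from_zero[OF 1 this]
  have B1: "\<bar>v (x + a, y + b) - b * vy (x, y) - v (x + a, y)\<bar> \<le> C * ?r powr s * \<bar>b\<bar>" by simp
  have "\<bar>vx (x + t, y) - vx (x, y)\<bar> \<le> C * ?r powr s" if "\<bar>t\<bar> \<le> \<bar>a\<bar>" for t
    using that by (intro order_trans[OF hx nm])
      (auto simp: dist_norm intro!: norm_pair_mono order_trans[OF that ab(1)])
  from deriv_bound_from_zero[OF 2 this]
  have B2: "\<bar>v (x + a, y) - a * vx (x, y) - v (x, y)\<bar> \<le> C * ?r powr s * \<bar>a\<bar>" by simp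
  have "C * ?r powr s * \<bar>b\<bar> \<le> C * ?r powr s * ?r" "C * ?r powr s * \<bar>a\<bar> \<le> C * ?r powr s * ?r"
    using ab assms by (auto intro!: mult_left_mono)
  moreover have "?r powr s * ?r = ?r powr (1 + s)"
    by (metis mult.commute norm_ge_zero powr_mult_base)
  ultimately show ?thesis using B1 B2 by (simp add: mult.assoc)
qed

text \<open>The first-order terms cancel in the symmetric sum.\<close>

lemma sum4_C1_holder:
  fixes v vx vy :: "real \<times> real \<Rightarrow> real"
  assumes dx: "\<And>a b. ((\<lambda>t. v (t, b)) has_real_derivative vx (a, b)) (at a)"
    and dy: "\<And>a b. ((\<lambda>t. v (a, t)) has_real_derivative vy (a, b)) (at b)"
    and hx: "\<And>p q. \<bar>vx p - vx q\<bar> \<le> C * dist p q powr s"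
    and hy: "\<And>p q. \<bar>vy p - vy q\<bar> \<le> C * dist p q powr s"
    and "0 < s" "0 \<le> C"
  shows "\<bar>sum4 v x z - 4 * v x\<bar> \<le> 8 * C * norm z powr (1 + s)"
proof -
  note T = first_order_taylor_holder[OF assms, of "fst x" _ "snd x"]
  have "norm (a, b) = norm z" if "\<bar>a\<bar> = \<bar>fst z\<bar>" "\<bar>b\<bar> = \<bar>snd z\<bar>" for a b
    using that by (auto intro!: antisym norm_pair_mono)
  note n = this[of "fst z" "snd z"] this[of "fst z" "- snd z"] this[of "- fst z" "snd z"] this[of "- fst z" "- snd z"]
  show ?thesis
    using T[of "fst z" "snd z"] T[of "fst z" "- snd z"] T[of "- fst z" "snd z"] T[of "- fst z" "- snd z"]
    unfolding sum4_def by (simp add: n)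
qed

lemma holder_space_partial:
  assumes "u \<in> holder_space k s" "length bs < k"
  shows "((\<lambda>t. dpart bs u (t, b)) has_real_derivative dpart (False # bs) u (a, b)) (at a)"
    and "((\<lambda>t. dpart bs u (a, t)) has_real_derivative dpart (True # bs) u (a, b)) (at b)"
proof -
  have "(\<lambda>t. dpart bs u (t, snd (a, b))) differentiable (at (fst (a, b)))"
    "(\<lambda>t. dpart bs u (fst (a, b), t)) differentiable (at (snd (a, b)))"
    using assms unfolding holder_space_def by blast+
  then show "((\<lambda>t. dpart bs u (t, b)) has_real_derivative dpart (False # bs) u (a, b)) (at a)"
    "((\<lambda>t. dpart bs u (a, t)) has_real_derivative dpart (True # bs) u (a, b)) (at b)"
    by (simp_all add: partial_x_def partial_y_def DERIV_deriv_iff_real_differentiable)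
qed

lemma holder_space_holder:
  assumes "u \<in> holder_space k s" "length bs = k"
  obtains C where "0 \<le> C" "\<And>p q. \<bar>dpart bs u p - dpart bs u q\<bar> \<le> C * dist p q powr s"
proof -
  obtain C where C: "\<And>p q. \<bar>dpart bs u p - dpart bs u q\<bar> \<le> C * dist p q powr s"
    using assms unfolding holder_space_def by blast
  have "\<bar>dpart bs u p - dpart bs u q\<bar> \<le> \<bar>C\<bar> * dist p q powr s" for p q
    by (rule order_trans[OF C]) (simp add: mult_right_mono)
  then show thesis using that[of "\<bar>C\<bar>"] by simp
qed

text \<open>The two smoothness classes lead to the same order. For alpha < 1 the second derivatives
  are themselves Hoelder with exponent alpha + eps. For alpha >= 1 the third derivatives are Hoelder
  with exponent alpha - 1 + eps, and the missing power is gained because the symmetric sum cancels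
  the first-order terms.\<close>

lemma sum4_second_derivative_bound:
  assumes \<alpha>: "0 < \<alpha>" "\<alpha> < 2" and \<epsilon>: "0 < \<epsilon>"
    and u: "u \<in> holder_space (2 + nat \<lfloor>\<alpha>\<rfloor>) (\<alpha> - of_int \<lfloor>\<alpha>\<rfloor> + \<epsilon>)"
    and len: "length bs = 2"
  shows "\<exists>K\<ge>0. \<forall>x z. \<bar>sum4 (dpart bs u) x z - 4 * dpart bs u x\<bar> \<le> K * norm z powr (\<alpha> + \<epsilon>)"
proof (cases "\<alpha> < 1")
  case True
  then have "\<lfloor>\<alpha>\<rfloor> = 0" using \<alpha> by linarith
  then have u': "u \<in> holder_space 2 (\<alpha> + \<epsilon>)" using u by simp
  obtain C where "0 \<le> C" "\<And>p q. \<bar>dpart bs u p - dpart bs u q\<bar> \<le> C * dist p q powr (\<alpha> + \<epsilon>)"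
    using holder_space_holder[OF u' len] by blast
  then show ?thesis by (intro exI[of _ "4 * C"]) (auto intro!: sum4_holder)
next
  case False
  then have fl: "\<lfloor>\<alpha>\<rfloor> = 1" using \<alpha> by linarith
  define s where "s = \<alpha> - 1 + \<epsilon>"
  have u': "u \<in> holder_space 3 s" using u by (simp add: fl s_def numeral_3_eq_3)
  obtain C1 where C1: "0 \<le> C1" "\<And>p q. \<bar>dpart (False # bs) u p - dpart (False # bs) u q\<bar> \<le> C1 * dist p q powr s"
    using holder_space_holder[OF u', of "False # bs"] len by auto
  obtain C2 where C2: "0 \<le> C2" "\<And>p q. \<bar>dpart (True # bs) u p - dpart (True # bs) u q\<bar> \<le> C2 * dist p q powr s"
    using holder_space_holder[OF u', of "True # bs"] len by auto
  have l: "length bs < 3" using len by simp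
  have m: "C1 * dist p q powr s \<le> (C1 + C2) * dist p q powr s" "C2 * dist p q powr s \<le> (C1 + C2) * dist p q powr s"
    for p q :: "real \<times> real"
    using C1 C2 by (auto intro!: mult_right_mono)
  have "\<bar>sum4 (dpart bs u) x z - 4 * dpart bs u x\<bar> \<le> 8 * (C1 + C2) * norm z powr (1 + s)" for x z
    using False \<epsilon> C1(1) C2(1)
    by (intro sum4_C1_holder[OF holder_space_partial(1)[OF u' l] holder_space_partial(2)[OF u' l]]
        order_trans[OF C1(2) m(1)] order_trans[OF C2(2) m(2)]) (auto simp: s_def)
  then show ?thesis using C1(1) C2(1) by (intro exI[of _ "8 * (C1 + C2)"]) (auto simp: s_def)
qed

text \<open>Mixed derivatives are absent because a tensor product trapezoidal rule only sees pure ones.\<close>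

definition vanishing_order :: "real \<Rightarrow> real \<Rightarrow> (real \<times> real \<Rightarrow> real) \<Rightarrow> (real \<times> real \<Rightarrow> real) \<Rightarrow> (real \<times> real \<Rightarrow> real)
    \<Rightarrow> (real \<times> real \<Rightarrow> real) \<Rightarrow> (real \<times> real \<Rightarrow> real) \<Rightarrow> bool" where
  "vanishing_order \<sigma> K g gx gxx gy gyy \<longleftrightarrow> (\<forall>a b.
     ((\<lambda>t. g (t, b)) has_real_derivative gx (a, b)) (at a) \<and>
     ((\<lambda>t. gx (t, b)) has_real_derivative gxx (a, b)) (at a) \<and>
     ((\<lambda>t. g (a, t)) has_real_derivative gy (a, b)) (at b) \<and>
     ((\<lambda>t. gy (a, t)) has_real_derivative gyy (a, b)) (at b)) \<and> (\<forall>z.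
     \<bar>g z\<bar> \<le> 2 * K * norm z powr (\<sigma> + 2) \<and>
     \<bar>gx z\<bar> \<le> K * norm z powr (\<sigma> + 1) \<and> \<bar>gy z\<bar> \<le> K * norm z powr (\<sigma> + 1) \<and>
     \<bar>gxx z\<bar> \<le> K * norm z powr \<sigma> \<and> \<bar>gyy z\<bar> \<le> K * norm z powr \<sigma>)"

text \<open>Bounds on the pure second derivatives are integrated towards the origin.
  \<open>gx\<close> vanishes on the axis where the first coordinate is 0 and \<open>gy\<close> on
  the other axis, so one integration bounds each of them. For g the path from the origin runs along
  the horizontal axis and then vertically; its two legs explain the factor 2 in
  \<open>vanishing_order\<close>.\<close>

lemma vanishing_orderI:
  assumes dx: "\<And>a b. ((\<lambda>t. g (t, b)) has_real_derivative gx (a, b)) (at a)"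
    and dxx: "\<And>a b. ((\<lambda>t. gx (t, b)) has_real_derivative gxx (a, b)) (at a)"
    and dy: "\<And>a b. ((\<lambda>t. g (a, t)) has_real_derivative gy (a, b)) (at b)"
    and dyy: "\<And>a b. ((\<lambda>t. gy (a, t)) has_real_derivative gyy (a, b)) (at b)"
    and bxx: "\<And>z. \<bar>gxx z\<bar> \<le> K * norm z powr \<sigma>" and byy: "\<And>z. \<bar>gyy z\<bar> \<le> K * norm z powr \<sigma>"
    and zero: "g (0, 0) = 0" "\<And>b. gx (0, b) = 0" "\<And>a. gy (a, 0) = 0"
    and K: "0 \<le> K" "0 \<le> \<sigma>"
  shows "vanishing_order \<sigma> K g gx gxx gy gyy"
proof -
  have e: "norm z powr p * norm z = norm z powr (p + 1)" for z :: "real \<times> real" and p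
    by (metis mult.commute norm_ge_zero powr_mult_base add.commute)
  have mono: "K * norm w powr p \<le> K * norm z powr p" if "norm w \<le> norm z" "0 \<le> p" for w z :: "real \<times> real" and p
    using that K by (intro mult_left_mono powr_mono2) auto
  have bx: "\<bar>gx z\<bar> \<le> K * norm z powr (\<sigma> + 1)" for z
  proof -
    have "\<bar>gx (fst z, snd z) - gx (0, snd z)\<bar> \<le> K * norm z powr \<sigma> * \<bar>fst z\<bar>"
      by (rule deriv_bound_from_zero[OF dxx], rule order_trans[OF bxx], rule mono)
         (use K in \<open>auto intro!: norm_pair_mono\<close>)
    also have "\<dots> \<le> K * norm z powr \<sigma> * norm z"
      using K by (intro mult_left_mono abs_fst_le_norm) auto
    finally show ?thesis using zero(2) e[of z \<sigma>] by (simp add: mult.assoc)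
  qed
  have bY: "\<bar>gy z\<bar> \<le> K * norm z powr (\<sigma> + 1)" for z
  proof -
    have "\<bar>gy (fst z, snd z) - gy (fst z, 0)\<bar> \<le> K * norm z powr \<sigma> * \<bar>snd z\<bar>"
      by (rule deriv_bound_from_zero[OF dyy], rule order_trans[OF byy], rule mono)
         (use K in \<open>auto intro!: norm_pair_mono\<close>)
    also have "\<dots> \<le> K * norm z powr \<sigma> * norm z"
      using K by (intro mult_left_mono abs_snd_le_norm) auto
    finally show ?thesis using zero(3) e[of z \<sigma>] by (simp add: mult.assoc)
  qed
  have b0: "\<bar>g z\<bar> \<le> 2 * K * norm z powr (\<sigma> + 2)" for z
  proof -
    have "\<bar>g (fst z, snd z) - g (fst z, 0)\<bar> \<le> K * norm z powr (\<sigma> + 1) * \<bar>snd z\<bar>"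
      by (rule deriv_bound_from_zero[OF dy], rule order_trans[OF bY], rule mono)
         (use K in \<open>auto intro!: norm_pair_mono\<close>)
    also have "\<dots> \<le> K * norm z powr (\<sigma> + 1) * norm z"
      using K by (intro mult_left_mono abs_snd_le_norm) auto
    finally have 1: "\<bar>g z - g (fst z, 0)\<bar> \<le> K * norm z powr (\<sigma> + 1) * norm z" by simp
    have "\<bar>g (fst z, 0) - g (0, 0)\<bar> \<le> K * norm z powr (\<sigma> + 1) * \<bar>fst z\<bar>"
      by (rule deriv_bound_from_zero[OF dx], rule order_trans[OF bx], rule mono)
         (use K in \<open>auto intro: order_trans[OF _ abs_fst_le_norm]\<close>)
    also have "\<dots> \<le> K * norm z powr (\<sigma> + 1) * norm z"
      using K by (intro mult_left_mono abs_fst_le_norm) auto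
    finally have 2: "\<bar>g (fst z, 0) - g (0, 0)\<bar> \<le> K * norm z powr (\<sigma> + 1) * norm z" .
    show ?thesis using 1 2 zero(1) e[of z "\<sigma> + 1"] by (simp add: mult.assoc add.assoc)
  qed
  show ?thesis
    unfolding vanishing_order_def using dx dxx dy dyy bxx byy bx bY b0 by blast
qed

text \<open>A and B are forced: the second derivative of \<open>sum4 u x\<close> in the first
  coordinate equals 4 \<open>uxx x\<close> at the origin, and 2 A (fst z)^2 contributes 4 A. The sum
  is even in each coordinate, so its first derivatives vanish on the respective axes. The order of
  quantifiers matters: K is chosen before x, while A and B may vary with x.\<close>

lemma second_difference_vanishing_order:
  assumes \<alpha>: "0 < \<alpha>" "\<alpha> < 2" and \<epsilon>: "0 < \<epsilon>"
    and u: "u \<in> holder_space (2 + nat \<lfloor>\<alpha>\<rfloor>) (\<alpha> - of_int \<lfloor>\<alpha>\<rfloor> + \<epsilon>)"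
  shows "\<exists>K\<ge>0. \<forall>x. \<exists>A B gx gxx gy gyy. vanishing_order (\<alpha> + \<epsilon>) K
    (\<lambda>z. sum4 u x z - 4 * u x - 2 * A * (fst z)\<^sup>2 - 2 * B * (snd z)\<^sup>2) gx gxx gy gyy"
proof -
  define ux uxx uy uyy where "ux = dpart [False] u" and "uxx = dpart [False, False] u"
    and "uy = dpart [True] u" and "uyy = dpart [True, True] u"
  obtain K1 where K1: "0 \<le> K1" "\<And>x z. \<bar>sum4 uxx x z - 4 * uxx x\<bar> \<le> K1 * norm z powr (\<alpha> + \<epsilon>)"
    using sum4_second_derivative_bound[OF assms, of "[False, False]"] unfolding uxx_def by auto
  obtain K2 where K2: "0 \<le> K2" "\<And>x z. \<bar>sum4 uyy x z - 4 * uyy x\<bar> \<le> K2 * norm z powr (\<alpha> + \<epsilon>)"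
    using sum4_second_derivative_bound[OF assms, of "[True, True]"] unfolding uyy_def by auto
  have d: "((\<lambda>t. u (t, b)) has_real_derivative ux (a, b)) (at a)"
    "((\<lambda>t. u (a, t)) has_real_derivative uy (a, b)) (at b)"
    "((\<lambda>t. ux (t, b)) has_real_derivative uxx (a, b)) (at a)"
    "((\<lambda>t. uy (a, t)) has_real_derivative uyy (a, b)) (at b)" for a b
    using holder_space_partial(1)[OF u, of "[]" b a] holder_space_partial(2)[OF u, of "[]" a b]
      holder_space_partial(1)[OF u, of "[False]" b a] holder_space_partial(2)[OF u, of "[True]" a b] unfolding ux_def uxx_def uy_def uyy_def by simp_all
  have sh: "((\<lambda>t. f (c + t)) has_real_derivative D) (at t)"
    if "(f has_real_derivative D) (at (c + t))" for f :: "real \<Rightarrow> real" and c t D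
    using that DERIV_shift[of f D t c] by (simp add: add.commute)
  have sm: "((\<lambda>t. f (c - t)) has_real_derivative - D) (at t)"
    if "(f has_real_derivative D) (at (c - t))" for f :: "real \<Rightarrow> real" and c t D
  proof -
    have "((\<lambda>t. c - t) has_real_derivative - 1) (at t)" by (auto intro!: derivative_eq_intros)
    from DERIV_chain2[OF that this] show ?thesis by simp
  qed
  note dp = d[THEN sh] d[THEN sm]
  have "vanishing_order (\<alpha> + \<epsilon>) (K1 + K2)
    (\<lambda>z. sum4 u x z - 4 * u x - 2 * uxx x * (fst z)\<^sup>2 - 2 * uyy x * (snd z)\<^sup>2)
    (\<lambda>z. ux (fst x + fst z, snd x + snd z) + ux (fst x + fst z, snd x - snd z)
       - ux (fst x - fst z, snd x + snd z) - ux (fst x - fst z, snd x - snd z) - 4 * uxx x * fst z)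
    (\<lambda>z. sum4 uxx x z - 4 * uxx x)
    (\<lambda>z. uy (fst x + fst z, snd x + snd z) - uy (fst x + fst z, snd x - snd z)
       + uy (fst x - fst z, snd x + snd z) - uy (fst x - fst z, snd x - snd z) - 4 * uyy x * snd z)
    (\<lambda>z. sum4 uyy x z - 4 * uyy x)" for x
  proof (rule vanishing_orderI)
    show "\<bar>sum4 uxx x z - 4 * uxx x\<bar> \<le> (K1 + K2) * norm z powr (\<alpha> + \<epsilon>)" for z
      using K2(1) by (intro order_trans[OF K1(2)] mult_right_mono) auto
    show "\<bar>sum4 uyy x z - 4 * uyy x\<bar> \<le> (K1 + K2) * norm z powr (\<alpha> + \<epsilon>)" for z
      using K1(1) by (intro order_trans[OF K2(2)] mult_right_mono) auto
  qed (use K1(1) K2(1) \<alpha> \<epsilon> in \<open>auto simp: sum4_def intro!: derivative_eq_intros dp\<close>)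
  then show ?thesis using K1(1) K2(1) by (intro exI[of _ "K1 + K2"]) fastforce
qed

section \<open>Summation of the cell errors\<close>

text \<open>The upper ends are written as a + h to match the shape of the cell in
  \<open>weighted_cell_quadrature\<close>.\<close>

definition cell :: "real \<Rightarrow> nat \<Rightarrow> nat \<Rightarrow> (real \<times> real) set" where
  "cell h i j = {real i * h..real i * h + h} \<times> {real j * h..real j * h + h}"

text \<open>In the cell at the origin the coefficients 2, 2, 0 of the scheme, divided by 4, leave
  the mean of the two nodes on the axes. The corner at the origin, where the quotient has no
  meaningful value, is never sampled.\<close>

definition cell_avg :: "real \<Rightarrow> (real \<times> real \<Rightarrow> real) \<Rightarrow> nat \<Rightarrow> nat \<Rightarrow> real" where
  "cell_avg h f i j = (if (i, j) = (0, 0) then (f (h, 0) + f (0, h)) / 2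
     else (f (real i * h, real j * h) + f (real i * h, real j * h + h)
         + f (real i * h + h, real j * h) + f (real i * h + h, real j * h + h)) / 4)"

definition cell_error :: "real \<Rightarrow> real \<Rightarrow> (real \<times> real \<Rightarrow> real) \<Rightarrow> nat \<Rightarrow> nat \<Rightarrow> real" where
  "cell_error \<alpha> h f i j = (LINT z:cell h i j|lborel. (f z - cell_avg h f i j) * norm z powr - \<alpha>)"

lemma cell_sets [measurable]: "cell h i j \<in> sets borel"
  unfolding cell_def by (intro borel_closed closed_Times) auto

lemma cell_subset:
  assumes "0 \<le> h" "i < N" "j < N"
  shows "cell h i j \<subseteq> {0..real N * h} \<times> {0..real N * h}"
proof -
  have "real k * h + h \<le> real N * h" "0 \<le> real k * h" if "k < N" for k
  proof -
    have "(real k + 1) * h \<le> real N * h" using that assms(1) by (intro mult_right_mono) auto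
    then show "real k * h + h \<le> real N * h" "0 \<le> real k * h" using assms(1) by (auto simp: algebra_simps)
  qed
  then have "{real k * h..real k * h + h} \<subseteq> {0..real N * h}" if "k < N" for k
    using that by (intro atLeastatMost_subset_iff[THEN iffD2] disjI2 conjI)
  then show ?thesis using assms(2,3) unfolding cell_def by (meson Sigma_mono)
qed

lemma set_integrable_weighted:
  fixes f :: "real \<times> real \<Rightarrow> real"
  assumes "0 < \<alpha>" "\<alpha> < 2" "0 \<le> c" and f [measurable]: "f \<in> borel_measurable borel"
    and S [measurable]: "S \<in> sets borel" and "S \<subseteq> {0..c} \<times> {0..c}" and M: "\<And>z. z \<in> S \<Longrightarrow> \<bar>f z\<bar> \<le> M"
  shows "set_integrable lborel S (\<lambda>z. f z * norm z powr - \<alpha>)"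
proof -
  have "set_integrable lborel S (\<lambda>z. norm z powr - \<alpha>)"
    by (rule set_integrable_subset[OF set_integrable_norm_powr_square(1)[OF assms(1-3)]]) (use assms in auto)
  then have "set_integrable lborel S (\<lambda>z. M * norm z powr - \<alpha>)" by simp
  then show ?thesis
    by (rule set_integrable_bound)
       (use M in \<open>auto simp: abs_mult set_borel_measurable_def intro!: AE_I2 mult_right_mono order_trans[OF M]\<close>)
qed

text \<open>Let r0 be the distance of the corner nearest to the origin. Off the origin cell h <= r0,
  so the whole cell lies between the radii r0 and 3 r0, and r0 can replace the norm everywhere.
  Feeding the bounds into \<open>weighted_cell_quadrature\<close> gives 170 = 2 * 25 + 2 * 15 * 4,
  and both terms carry the same power r0^(eps - 2).\<close>

lemma cell_error_off_origin:
  assumes g: "vanishing_order \<sigma> K g gx gxx gy gyy" and K: "0 \<le> K"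
    and par: "0 < \<alpha>" "\<alpha> < 2" "0 < \<epsilon>" "\<sigma> = \<alpha> + \<epsilon>" "\<sigma> \<le> 2" and h: "0 < h" and ij: "(i, j) \<noteq> (0, 0)"
    and gm: "g \<in> borel_measurable borel"
  shows "\<bar>cell_error \<alpha> h (\<lambda>z. g z / ((fst z)\<^sup>2 + (snd z)\<^sup>2)) i j\<bar>
    \<le> 170 * K * h ^ 4 * (h * real (max i j)) powr (\<epsilon> - 2)"
proof -
  define a b where "a = real i * h" and "b = real j * h"
  define f where "f z = g z / ((fst z)\<^sup>2 + (snd z)\<^sup>2)" for z
  define r0 where "r0 = norm (a, b)"
  define fx where "fx z = quot_d1 (\<lambda>t. g (t, snd z)) (\<lambda>t. gx (t, snd z)) (snd z) (fst z)" for z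
  define fxx where "fxx z = quot_d2 (\<lambda>t. g (t, snd z)) (\<lambda>t. gx (t, snd z)) (\<lambda>t. gxx (t, snd z)) (snd z) (fst z)" for z
  define fy where "fy z = quot_d1 (\<lambda>t. g (fst z, t)) (\<lambda>t. gy (fst z, t)) (fst z) (snd z)" for z
  define fyy where "fyy z = quot_d2 (\<lambda>t. g (fst z, t)) (\<lambda>t. gy (fst z, t)) (\<lambda>t. gyy (fst z, t)) (fst z) (snd z)" for z
  have C: "cell h i j = {a..a+h} \<times> {b..b+h}" unfolding cell_def a_def b_def ..
  have ab: "0 \<le> a" "0 \<le> b" using h by (auto simp: a_def b_def)
  have m1: "1 \<le> real (max i j)" using ij by (cases i; cases j) auto
  have hm: "h * real (max i j) \<le> r0"
    using abs_fst_le_norm[of "(a, b)"] abs_snd_le_norm[of "(a, b)"] ab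
    unfolding r0_def a_def b_def by (auto simp: max_def mult.commute)
  have hr: "h \<le> r0" using order_trans[OF mult_left_mono[OF m1, of h] hm] h by simp
  have r0: "0 < r0" using h hr by linarith
  have z: "r0 \<le> norm z \<and> norm z \<le> r0 + 2 * h" if "z \<in> cell h i j" for z
  proof
    have zc: "a \<le> fst z" "fst z \<le> a + h" "b \<le> snd z" "snd z \<le> b + h" using that unfolding C by auto
    show "r0 \<le> norm z" unfolding r0_def using zc ab by (intro norm_pair_mono) auto
    have "norm z = norm ((a, b) + (fst z - a, snd z - b))" by simp
    also have "\<dots> \<le> r0 + norm (fst z - a, snd z - b)" unfolding r0_def by (rule norm_triangle_ineq)
    also have "norm (fst z - a, snd z - b) \<le> \<bar>fst z - a\<bar> + \<bar>snd z - b\<bar>"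
      using norm_Pair_le[of "fst z - a" "snd z - b"] by simp
    also have "\<bar>fst z - a\<bar> + \<bar>snd z - b\<bar> \<le> 2 * h" using zc by auto
    finally show "norm z \<le> r0 + 2 * h" by simp
  qed
  then have z3: "0 < norm z" "norm z \<le> 3 * r0" if "z \<in> cell h i j" for z
    using that hr r0 by fastforce+
  have gd: "((\<lambda>t. g (t, y)) has_real_derivative gx (x, y)) (at x)"
    "((\<lambda>t. gx (t, y)) has_real_derivative gxx (x, y)) (at x)"
    "((\<lambda>t. g (x, t)) has_real_derivative gy (x, y)) (at y)"
    "((\<lambda>t. gy (x, t)) has_real_derivative gyy (x, y)) (at y)" for x y
    using g unfolding vanishing_order_def by blast+
  have gb: "\<bar>g z\<bar> \<le> 2 * K * norm z powr (\<sigma> + 2)"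
     "\<bar>gx z\<bar> \<le> K * norm z powr (\<sigma> + 1)" "\<bar>gy z\<bar> \<le> K * norm z powr (\<sigma> + 1)"
     "\<bar>gxx z\<bar> \<le> K * norm z powr \<sigma>" "\<bar>gyy z\<bar> \<le> K * norm z powr \<sigma>" for z
    using g unfolding vanishing_order_def by blast+
  have r2: "(norm z)\<^sup>2 = (fst z)\<^sup>2 + (snd z)\<^sup>2" "(norm z)\<^sup>2 = (snd z)\<^sup>2 + (fst z)\<^sup>2" for z :: "real \<times> real"
    by (simp_all add: norm_pair_sq)
  \<comment> \<open>The sign of \<open>\<sigma>\<close> - 1 is open. If the power increases, the
    radius 3 r0 costs a factor 3^(\<open>\<sigma>\<close> - 1) <= 3; otherwise the near corner is
    the worst point.\<close>
  have B1: "5 * K * norm z powr (\<sigma> - 1) \<le> 15 * K * r0 powr (\<sigma> - 1)" if "z \<in> cell h i j" for z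
  proof -
    have "norm z powr (\<sigma> - 1) \<le> 3 * r0 powr (\<sigma> - 1)"
    proof (cases "1 \<le> \<sigma>")
      case True
      have "norm z powr (\<sigma> - 1) \<le> (3 * r0) powr (\<sigma> - 1)"
        using z3[OF that] True by (intro powr_mono2) auto
      also have "\<dots> = 3 powr (\<sigma> - 1) * r0 powr (\<sigma> - 1)" using r0 by (simp add: powr_mult)
      also have "\<dots> \<le> 3 powr 1 * r0 powr (\<sigma> - 1)"
        using par by (intro mult_right_mono powr_mono) auto
      finally show ?thesis by simp
    next
      case False
      have "norm z powr (\<sigma> - 1) \<le> r0 powr (\<sigma> - 1)"
        using z[OF that] r0 False by (intro powr_mono2') auto
      then show ?thesis using powr_ge_zero[of r0 "\<sigma> - 1"] by linarith
    qed
    from mult_left_mono[OF this, of "5 * K"] show ?thesis using K by simp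
  qed
  have B2: "25 * K * norm z powr (\<sigma> - 2) \<le> 25 * K * r0 powr (\<sigma> - 2)" if "z \<in> cell h i j" for z
    using z[OF that] r0 par K by (intro mult_left_mono powr_mono2') auto
  \<comment> \<open>The derivative of t^(-alpha) is at most 2 r0^(-alpha - 1) beyond r0, because
    alpha < 2, and the norm varies by at most 2 h over the cell.\<close>
  have w: "\<bar>norm z powr - \<alpha> - r0 powr - \<alpha>\<bar> \<le> 4 * h * r0 powr (- \<alpha> - 1)" "\<bar>norm z powr - \<alpha>\<bar> \<le> r0 powr - \<alpha>"
    if "z \<in> cell h i j" for z
  proof -
    have "norm (norm z powr - \<alpha> - r0 powr - \<alpha>) \<le> 2 * r0 powr (- \<alpha> - 1) * norm (norm z - r0)"
    proof (rule field_differentiable_bound[of "{r0..r0 + 2 * h}" _ "\<lambda>t. - \<alpha> * t powr (- \<alpha> - 1)"])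
      show "((\<lambda>t. t powr - \<alpha>) has_real_derivative - \<alpha> * t powr (- \<alpha> - 1)) (at t within {r0..r0 + 2 * h})"
        if "t \<in> {r0..r0 + 2 * h}" for t
        using that r0 has_real_derivative_powr[of t "- \<alpha>"] by (auto intro: has_field_derivative_at_within)
      show "norm (- \<alpha> * t powr (- \<alpha> - 1)) \<le> 2 * r0 powr (- \<alpha> - 1)" if "t \<in> {r0..r0 + 2 * h}" for t
        using that r0 par by (auto simp: abs_mult intro!: mult_mono powr_mono2')
    qed (use z[OF that] h in auto)
    also have "\<dots> \<le> 2 * r0 powr (- \<alpha> - 1) * (2 * h)"
      using z[OF that] by (intro mult_left_mono) auto
    finally show "\<bar>norm z powr - \<alpha> - r0 powr - \<alpha>\<bar> \<le> 4 * h * r0 powr (- \<alpha> - 1)" by (simp add: mult_ac)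
    show "\<bar>norm z powr - \<alpha>\<bar> \<le> r0 powr - \<alpha>"
      using z[OF that] r0 par by (auto intro!: powr_mono2')
  qed
  have fm: "f \<in> borel_measurable borel"
    unfolding f_def[abs_def] using gm by (intro borel_measurable_divide) (auto intro!: borel_measurable_continuous_onI continuous_intros)
  have av: "cell_avg h f i j = (f (a, b) + f (a, b + h) + f (a + h, b) + f (a + h, b + h)) / 4"
    using ij unfolding cell_avg_def a_def b_def by auto
  have fb: "\<bar>f z\<bar> \<le> 2 * K * (3 * r0) powr \<sigma>" if "z \<in> cell h i j" for z
  proof -
    have "\<bar>f z\<bar> \<le> 2 * K * norm z powr \<sigma>"
      using quot_bounds(1)[of "norm z" "fst z" "snd z" "\<lambda>t. g (t, snd z)" K \<sigma> "\<lambda>t. gx (t, snd z)" "\<lambda>t. gxx (t, snd z)"]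
        z3[OF that] r2 gb[of z] unfolding f_def by simp
    also have "\<dots> \<le> 2 * K * (3 * r0) powr \<sigma>"
      using z3[OF that] K par by (intro mult_left_mono powr_mono2) auto
    finally show ?thesis .
  qed
  \<comment> \<open>Any grid square that contains the cell will do; it serves only to make the
    weight integrable there.\<close>
  define N where "N = Suc (max i j)"
  have sub: "cell h i j \<subseteq> {0..real N * h} \<times> {0..real N * h}"
    using h by (intro cell_subset) (auto simp: N_def)
  have int: "set_integrable lborel (cell h i j) (\<lambda>z. (f z - cell_avg h f i j) * norm z powr - \<alpha>)"
  proof (rule set_integrable_weighted[OF par(1,2) _ _ cell_sets sub])
    show "\<bar>f z - cell_avg h f i j\<bar> \<le> 2 * K * (3 * r0) powr \<sigma> + \<bar>cell_avg h f i j\<bar>" if "z \<in> cell h i j" for z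
      using fb[OF that] by linarith
  qed (use h fm in auto)
  have "\<bar>cell_error \<alpha> h f i j\<bar> \<le> (2 * (25 * K * r0 powr (\<sigma> - 2)) * h\<^sup>2 * r0 powr - \<alpha>
      + 2 * (15 * K * r0 powr (\<sigma> - 1)) * h * (4 * h * r0 powr (- \<alpha> - 1))) * h\<^sup>2"
    unfolding cell_error_def C av
  proof (rule weighted_cell_quadrature[OF h, where fx = fx and fxx = fxx and fy = fy and fyy = fyy and ?w0.0 = "r0 powr - \<alpha>"])
    fix x y assume xy: "(x, y) \<in> {a..a+h} \<times> {b..b+h}"
    then have ne: "x\<^sup>2 + y\<^sup>2 \<noteq> 0" "y\<^sup>2 + x\<^sup>2 \<noteq> 0"
      using z3(1)[of "(x, y)"] r2[of "(x, y)"] unfolding C by (auto simp: zero_prod_def)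
    show "((\<lambda>t. f (t, y)) has_real_derivative fx (x, y)) (at x)"
      "((\<lambda>t. fx (t, y)) has_real_derivative fxx (x, y)) (at x)"
      using has_derivative_quot[of "\<lambda>t. g (t, y)" "\<lambda>t. gx (t, y)" x "\<lambda>t. gxx (t, y)" y, OF gd(1) gd(2) ne(1)] by (simp_all add: f_def fx_def fxx_def)
    show "((\<lambda>t. f (x, t)) has_real_derivative fy (x, y)) (at y)"
      "((\<lambda>t. fy (x, t)) has_real_derivative fyy (x, y)) (at y)"
      using has_derivative_quot[of "\<lambda>t. g (x, t)" "\<lambda>t. gy (x, t)" y "\<lambda>t. gyy (x, t)" x, OF gd(3) gd(4) ne(2)] by (simp_all add: f_def fy_def fyy_def add.commute)
  next
    fix z assume "z \<in> {a..a+h} \<times> {b..b+h}"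
    then have zc: "z \<in> cell h i j" unfolding C .
    show "\<bar>fx z\<bar> \<le> 15 * K * r0 powr (\<sigma> - 1)"
      unfolding fx_def
      by (rule order_trans[OF quot_bounds(2)[of "norm z" _ _ _ _ _ _ "\<lambda>t. gxx (t, snd z)"] B1[OF zc]]) (use z3(1)[OF zc] gb[of z] r2 in auto)
    show "\<bar>fy z\<bar> \<le> 15 * K * r0 powr (\<sigma> - 1)"
      unfolding fy_def
      by (rule order_trans[OF quot_bounds(2)[of "norm z" _ _ _ _ _ _ "\<lambda>t. gyy (fst z, t)"] B1[OF zc]]) (use z3(1)[OF zc] gb[of z] r2 in auto)
    show "\<bar>fxx z\<bar> \<le> 25 * K * r0 powr (\<sigma> - 2)"
      unfolding fxx_def
      by (rule order_trans[OF quot_bounds(3)[of "norm z"] B2[OF zc]]) (use z3(1)[OF zc] gb[of z] r2 in auto)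
    show "\<bar>fyy z\<bar> \<le> 25 * K * r0 powr (\<sigma> - 2)"
      unfolding fyy_def
      by (rule order_trans[OF quot_bounds(3)[of "norm z"] B2[OF zc]]) (use z3(1)[OF zc] gb[of z] r2 in auto)
    show "\<bar>norm z powr - \<alpha> - r0 powr - \<alpha>\<bar> \<le> 4 * h * r0 powr (- \<alpha> - 1)" "\<bar>norm z powr - \<alpha>\<bar> \<le> r0 powr - \<alpha>"
      using w[OF zc] by auto
  qed (use int in \<open>unfold C av, auto\<close>)
  also have "\<dots> = 170 * K * h ^ 4 * r0 powr (\<epsilon> - 2)"
  proof -
    have "r0 powr (\<sigma> - 2) * r0 powr - \<alpha> = r0 powr (\<epsilon> - 2)" "r0 powr (\<sigma> - 1) * r0 powr (- \<alpha> - 1) = r0 powr (\<epsilon> - 2)"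
      unfolding powr_add[symmetric] by (simp_all add: par(4) algebra_simps)
    moreover have "(2 * (25 * K * p) * h\<^sup>2 * q + 2 * (15 * K * p') * h * (4 * h * q')) * h\<^sup>2
      = 50 * K * h ^ 4 * (p * q) + 120 * K * h ^ 4 * (p' * q')" for p q p' q'
      by (simp add: algebra_simps power2_eq_square power4_eq_xxxx)
    ultimately show ?thesis by simp
  qed
  also have "\<dots> \<le> 170 * K * h ^ 4 * (h * real (max i j)) powr (\<epsilon> - 2)"
    using hm K h m1 par by (intro mult_left_mono powr_mono2') auto
  finally show ?thesis unfolding f_def[abs_def] .
qed

text \<open>No interpolation takes place: the values of the quotient and their mean are already
  small. As |z| <= 2 h and \<open>\<sigma>\<close> <= 2, the values are at most 2 K * 4
  h^\<open>\<sigma>\<close> and the mean at most 2 K h^\<open>\<sigma>\<close>, together 10 K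
  h^\<open>\<sigma>\<close>. The weight has mass of order h^(2 - alpha).\<close>

lemma cell_error_origin:
  assumes g: "vanishing_order \<sigma> K g gx gxx gy gyy" and K: "0 \<le> K"
    and par: "0 < \<alpha>" "\<alpha> < 2" "0 < \<epsilon>" "\<sigma> = \<alpha> + \<epsilon>" "\<sigma> \<le> 2" and h: "0 < h"
    and gm: "g \<in> borel_measurable borel"
  shows "\<bar>cell_error \<alpha> h (\<lambda>z. g z / ((fst z)\<^sup>2 + (snd z)\<^sup>2)) 0 0\<bar>
    \<le> 10 * K / (1 - \<alpha> / 2)\<^sup>2 * h powr (2 + \<epsilon>)"
proof -
  define f where "f z = g z / ((fst z)\<^sup>2 + (snd z)\<^sup>2)" for z
  have C: "cell h 0 0 = {0..h} \<times> {0..h}" unfolding cell_def by simp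
  have fb: "\<bar>f z\<bar> \<le> 2 * K * norm z powr \<sigma>" for z
  proof (cases "z = 0")
    case False
    then show ?thesis
      using quot_bounds(1)[of "norm z" "fst z" "snd z" "\<lambda>t. g (t, snd z)" K \<sigma> "\<lambda>t. gx (t, snd z)" "\<lambda>t. gxx (t, snd z)"]
        norm_pair_sq[of z] g unfolding f_def vanishing_order_def by simp
  qed (simp add: f_def)
  have av: "\<bar>cell_avg h f 0 0\<bar> \<le> 2 * K * h powr \<sigma>"
    using fb[of "(h, 0)"] fb[of "(0, h)"] h unfolding cell_avg_def by simp
  have bd: "\<bar>f z - cell_avg h f 0 0\<bar> \<le> 10 * K * h powr \<sigma>" if "z \<in> cell h 0 0" for z
  proof -
    have "norm z \<le> \<bar>fst z\<bar> + \<bar>snd z\<bar>" using norm_Pair_le[of "fst z" "snd z"] by simp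
    then have "norm z \<le> 2 * h" using that unfolding C by auto
    then have "norm z powr \<sigma> \<le> (2 * h) powr \<sigma>" using par by (intro powr_mono2) auto
    also have "\<dots> = 2 powr \<sigma> * h powr \<sigma>" using h by (simp add: powr_mult)
    also have "\<dots> \<le> 2 powr 2 * h powr \<sigma>" using par by (intro mult_right_mono powr_mono) auto
    finally have "norm z powr \<sigma> \<le> 4 * h powr \<sigma>" by simp
    then have "2 * K * norm z powr \<sigma> \<le> 2 * K * (4 * h powr \<sigma>)" using K by (intro mult_left_mono) auto
    then show ?thesis using fb[of z] av by simp
  qed
  have fm: "f \<in> borel_measurable borel"
    unfolding f_def[abs_def] using gm by (intro borel_measurable_divide) (auto intro!: borel_measurable_continuous_onI continuous_intros)
  have h0: "0 \<le> h" using h by simp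
  have int: "set_integrable lborel (cell h 0 0) (\<lambda>z. (f z - cell_avg h f 0 0) * norm z powr - \<alpha>)"
    by (rule set_integrable_weighted[OF par(1,2) h0 _ cell_sets _ bd]) (use fm C in auto)
  note W = set_integrable_norm_powr_square[OF par(1,2) h0, folded C]
  have "\<bar>cell_error \<alpha> h f 0 0\<bar> \<le> (LINT z:cell h 0 0|lborel. \<bar>(f z - cell_avg h f 0 0) * norm z powr - \<alpha>\<bar>)"
    unfolding cell_error_def set_lebesgue_integral_def
    by (rule order_trans[OF integral_abs_bound]) (simp add: abs_mult)
  also have "\<dots> \<le> (LINT z:cell h 0 0|lborel. 10 * K * h powr \<sigma> * norm z powr - \<alpha>)"
    using int W(1) bd
    by (intro set_integral_mono set_integrable_abs) (auto simp: abs_mult intro!: mult_right_mono)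
  also have "\<dots> = 10 * K * h powr \<sigma> * (LINT z:cell h 0 0|lborel. norm z powr - \<alpha>)"
    by (rule set_integral_mult_right)
  also have "\<dots> \<le> 10 * K * h powr \<sigma> * (h powr (1 - \<alpha> / 2) / (1 - \<alpha> / 2))\<^sup>2"
    using W(2) K by (intro mult_left_mono) auto
  also have "\<dots> = 10 * K / (1 - \<alpha> / 2)\<^sup>2 * (h powr \<sigma> * (h powr (1 - \<alpha> / 2))\<^sup>2)"
    by (simp add: power_divide)
  also have "h powr \<sigma> * (h powr (1 - \<alpha> / 2))\<^sup>2 = h powr (2 + \<epsilon>)"
    unfolding power2_eq_square powr_add[symmetric] by (simp add: par(4) add.commute)
  finally show ?thesis unfolding f_def[abs_def] .
qed

section \<open>Power sums over the grid\<close>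

lemma sum_powr_le:
  fixes e :: real
  assumes "0 < e" "e \<le> 1"
  shows "(\<Sum>m<N. real m powr (e - 1)) \<le> real N powr e / e"
proof -
  have "(\<Sum>m<Suc N. real m powr (e - 1)) \<le> real N powr e / e" for N
  proof (induction N)
    case 0
    then show ?case by simp
  next
    case (Suc N)
    have "real (Suc N) powr (e - 1) \<le> real (Suc N) powr e / e - real N powr e / e"
    \<comment> \<open>For e < 1 the primitive t^e / e is not differentiable at 0, so the first step
      is done by hand; it says 1 <= 1 / e. Later terms are compared with the integral of the
      decreasing function t^(e - 1) over the preceding unit interval.\<close>
    proof (cases "N = 0")
      case True
      then show ?thesis using assms by simp
    next
      case False
      have "\<exists>z>real N. z < real (Suc N) \<and> real (Suc N) powr e / e - real N powr e / e = (real (Suc N) - real N) * z powr (e - 1)"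
        using False assms by (intro MVT2) (auto intro!: derivative_eq_intros)
      then obtain z where z: "real N < z" "z < real (Suc N)"
        "real (Suc N) powr e / e - real N powr e / e = z powr (e - 1)" by auto
      have "real (Suc N) powr (e - 1) \<le> z powr (e - 1)"
        using z assms by (intro powr_mono2') auto
      then show ?thesis using z(3) by simp
    qed
    then show ?case using Suc by simp
  qed
  note this[of N]
  moreover have "(\<Sum>m<N. real m powr (e - 1)) \<le> (\<Sum>m<Suc N. real m powr (e - 1))" by simp
  ultimately show ?thesis by linarith
qed

text \<open>Split the grid along its diagonal. Row i of one half has at most i + 1 <= 2 i entries,
  all equal to i^(e - 2), which leaves a one-dimensional sum of i^(e - 1). The two halves, both
  containing the diagonal, give the factor 4. The entry (0, 0) is harmless since
  \<open>0 powr _\<close> is 0.\<close>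

lemma sum_max_powr_le:
  fixes e :: real
  assumes "0 < e" "e \<le> 1"
  shows "(\<Sum>i<N. \<Sum>j<N. real (max i j) powr (e - 2)) \<le> 4 * real N powr e / e"
proof -
  let ?p = "\<lambda>m. real m powr (e - 2)"
  have half: "(\<Sum>j<N. if j \<le> i then ?p i else 0) \<le> 2 * real i powr (e - 1)" for i
  proof -
    have "(\<Sum>j<N. if j \<le> i then ?p i else 0) = (\<Sum>j\<in>{..<N} \<inter> {..i}. ?p i)"
      by (simp add: sum.If_cases Int_def atMost_def)
    also have "\<dots> = real (card ({..<N} \<inter> {..i})) * ?p i" by simp
    also have "\<dots> \<le> real (Suc i) * ?p i"
      using card_mono[of "{..i}" "{..<N} \<inter> {..i}"] by (intro mult_right_mono) auto
    also have "\<dots> \<le> 2 * real i powr (e - 1)"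
    proof (cases "i = 0")
      case False
      then have "real (Suc i) * ?p i \<le> (2 * real i) * ?p i" by (intro mult_right_mono) auto
      also have "\<dots> = 2 * real i powr (e - 1)" using powr_mult_base[of "real i" "e - 2"] by simp
      finally show ?thesis .
    qed simp
    finally show ?thesis .
  qed
  have "(\<Sum>i<N. \<Sum>j<N. ?p (max i j)) \<le> (\<Sum>i<N. \<Sum>j<N. (if j \<le> i then ?p i else 0) + (if i \<le> j then ?p j else 0))"
    by (intro sum_mono) (auto simp: max_def)
  also have "\<dots> = (\<Sum>i<N. \<Sum>j<N. if j \<le> i then ?p i else 0) + (\<Sum>i<N. \<Sum>j<N. if i \<le> j then ?p j else 0)"
    by (simp add: sum.distrib)
  also have "(\<Sum>i<N. \<Sum>j<N. if i \<le> j then ?p j else 0) = (\<Sum>j<N. \<Sum>i<N. if i \<le> j then ?p j else 0)"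
    by (rule sum.swap)
  also have "(\<Sum>i<N. \<Sum>j<N. if j \<le> i then ?p i else 0) + (\<Sum>j<N. \<Sum>i<N. if i \<le> j then ?p j else 0)
      \<le> (\<Sum>i<N. 2 * real i powr (e - 1)) + (\<Sum>i<N. 2 * real i powr (e - 1))"
    by (intro add_mono sum_mono half)
  also have "\<dots> = 4 * (\<Sum>i<N. real i powr (e - 1))" by (simp add: sum_distrib_left[symmetric])
  also have "\<dots> \<le> 4 * (real N powr e / e)" using sum_powr_le[OF assms] by (intro mult_left_mono) auto
  finally show ?thesis by simp
qed

text \<open>The sum over the grid grows like N^eps, and h^(2 + eps) N^eps = (N h)^eps h^2. As N h is
  the fixed side of the square, exactly h^2 remains. The constant 680 is 170 * 4.\<close>

lemma quadrature_error_vanishing: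
  assumes g: "vanishing_order \<sigma> K g gx gxx gy gyy" and K: "0 \<le> K"
    and par: "0 < \<alpha>" "\<alpha> < 2" "0 < \<epsilon>" "\<epsilon> \<le> 1" "\<sigma> = \<alpha> + \<epsilon>" "\<sigma> \<le> 2" and h: "0 < h"
    and gm: "g \<in> borel_measurable borel"
  shows "\<bar>\<Sum>i<N. \<Sum>j<N. cell_error \<alpha> h (\<lambda>z. g z / ((fst z)\<^sup>2 + (snd z)\<^sup>2)) i j\<bar>
    \<le> K * (680 / \<epsilon> + 10 / (1 - \<alpha> / 2)\<^sup>2) * (real N * h) powr \<epsilon> * h\<^sup>2"
proof (cases "N = 0")
  case False
  let ?E = "cell_error \<alpha> h (\<lambda>z. g z / ((fst z)\<^sup>2 + (snd z)\<^sup>2))"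
  define c where "c = 10 * K / (1 - \<alpha> / 2)\<^sup>2 * h powr (2 + \<epsilon>)"
  have c0: "0 \<le> c" using K by (simp add: c_def)
  have hh: "h ^ 4 * h powr (\<epsilon> - 2) = h powr (2 + \<epsilon>)" "h powr (2 + \<epsilon>) = h powr \<epsilon> * h\<^sup>2"
    using powr_realpow[OF h, of 4, symmetric] powr_realpow[OF h, of 2, symmetric]
    by (simp_all add: powr_add[symmetric] add.commute)
  \<comment> \<open>At (0, 0) the power of the maximum is 0 by convention, so the extra summand c
    carries the whole bound of the origin cell.\<close>
  have one: "\<bar>?E i j\<bar> \<le> 170 * K * h powr (2 + \<epsilon>) * real (max i j) powr (\<epsilon> - 2) + (if i = 0 \<and> j = 0 then c else 0)" for i j
  proof (cases "(i, j) = (0, 0)")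
    case True
    then show ?thesis using cell_error_origin[OF g K par(1,2,3,5,6) h gm] by (simp add: c_def)
  next
    case ne: False
    have "\<bar>?E i j\<bar> \<le> 170 * K * h ^ 4 * (h powr (\<epsilon> - 2) * real (max i j) powr (\<epsilon> - 2))"
      using cell_error_off_origin[OF g K par(1,2,3,5,6) h ne gm] h by (simp add: powr_mult)
    also have "\<dots> = 170 * K * (h ^ 4 * h powr (\<epsilon> - 2)) * real (max i j) powr (\<epsilon> - 2)" by (simp add: mult_ac)
    finally show ?thesis unfolding hh(1) using ne by auto
  qed
  have "\<bar>\<Sum>i<N. \<Sum>j<N. ?E i j\<bar> \<le> (\<Sum>i<N. \<Sum>j<N. \<bar>?E i j\<bar>)"
    by (rule order_trans[OF sum_abs sum_mono[OF sum_abs]])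
  also have "\<dots> \<le> (\<Sum>i<N. \<Sum>j<N. 170 * K * h powr (2 + \<epsilon>) * real (max i j) powr (\<epsilon> - 2) + (if i = 0 \<and> j = 0 then c else 0))"
    by (intro sum_mono one)
  also have "\<dots> = 170 * K * h powr (2 + \<epsilon>) * (\<Sum>i<N. \<Sum>j<N. real (max i j) powr (\<epsilon> - 2)) + c"
  proof -
    have "(\<Sum>j<N. if i = 0 \<and> j = 0 then c else 0) = (if i = 0 then c else 0)" for i
      using False by (cases "i = 0") auto
    then have "(\<Sum>i<N. \<Sum>j<N. if i = 0 \<and> j = 0 then c else 0) = (\<Sum>i<N. if i = 0 then c else 0)"
      by (intro sum.cong refl)
    also have "\<dots> = c" using False by simp
    finally show ?thesis by (simp add: sum.distrib sum_distrib_left)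
  qed
  also have "\<dots> \<le> 170 * K * h powr (2 + \<epsilon>) * (4 * real N powr \<epsilon> / \<epsilon>) + c"
    using sum_max_powr_le[OF par(3,4)] K by (intro add_mono mult_left_mono) auto
  also have "\<dots> = 680 * K / \<epsilon> * (real N powr \<epsilon> * h powr \<epsilon>) * h\<^sup>2 + 10 * K / (1 - \<alpha> / 2)\<^sup>2 * h powr \<epsilon> * h\<^sup>2"
    unfolding c_def hh(2) by (simp add: mult_ac)
  also have "\<dots> \<le> 680 * K / \<epsilon> * (real N * h) powr \<epsilon> * h\<^sup>2 + 10 * K / (1 - \<alpha> / 2)\<^sup>2 * (real N * h) powr \<epsilon> * h\<^sup>2"
  proof -
    have "h powr \<epsilon> \<le> (real N * h) powr \<epsilon>" using False h par by (intro powr_mono2) auto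
    moreover have "real N powr \<epsilon> * h powr \<epsilon> = (real N * h) powr \<epsilon>" by (simp add: powr_mult)
    ultimately show ?thesis using K par by (intro add_mono mult_right_mono mult_left_mono) auto
  qed
  finally show ?thesis by (simp add: algebra_simps)
qed simp

section \<open>Assembling the quadrature rule\<close>

lemma cell_avg_add: "cell_avg h (\<lambda>z. f z + g z) i j = cell_avg h f i j + cell_avg h g i j"
  by (simp add: cell_avg_def add_divide_distrib)

lemma cell_avg_mult: "cell_avg h (\<lambda>z. c * f z) i j = c * cell_avg h f i j"
  by (simp add: cell_avg_def algebra_simps)

lemma cell_error_integrable:
  fixes f :: "real \<times> real \<Rightarrow> real"
  assumes "0 < \<alpha>" "\<alpha> < 2" "0 < h" "f \<in> borel_measurable borel" "\<And>z. z \<in> cell h i j \<Longrightarrow> \<bar>f z\<bar> \<le> M"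
  shows "set_integrable lborel (cell h i j) (\<lambda>z. (f z - cell_avg h f i j) * norm z powr - \<alpha>)"
proof (rule set_integrable_weighted[OF assms(1,2) _ _ cell_sets cell_subset[of h i "Suc (max i j)" j]])
  show "\<bar>f z - cell_avg h f i j\<bar> \<le> M + \<bar>cell_avg h f i j\<bar>" if "z \<in> cell h i j" for z
    using assms(5)[OF that] by linarith
qed (use assms in auto)

lemma cell_error_add:
  fixes f g :: "real \<times> real \<Rightarrow> real"
  assumes "0 < \<alpha>" "\<alpha> < 2" "0 < h"
    and "f \<in> borel_measurable borel" "\<And>z. z \<in> cell h i j \<Longrightarrow> \<bar>f z\<bar> \<le> M"
    and "g \<in> borel_measurable borel" "\<And>z. z \<in> cell h i j \<Longrightarrow> \<bar>g z\<bar> \<le> M'"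
  shows "cell_error \<alpha> h (\<lambda>z. f z + g z) i j = cell_error \<alpha> h f i j + cell_error \<alpha> h g i j"
proof -
  have "cell_error \<alpha> h (\<lambda>z. f z + g z) i j = (LINT z:cell h i j|lborel.
      (f z - cell_avg h f i j) * norm z powr - \<alpha> + (g z - cell_avg h g i j) * norm z powr - \<alpha>)"
    unfolding cell_error_def cell_avg_add by (simp add: algebra_simps)
  also have "\<dots> = cell_error \<alpha> h f i j + cell_error \<alpha> h g i j"
    unfolding cell_error_def
    by (intro set_integral_add(2) cell_error_integrable[OF assms(1-3)]) (use assms in auto)
  finally show ?thesis .
qed

lemma cell_error_mult: "cell_error \<alpha> h (\<lambda>z. c * f z) i j = c * cell_error \<alpha> h f i j"
proof -
  have "cell_error \<alpha> h (\<lambda>z. c * f z) i j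
      = (LINT z:cell h i j|lborel. c * ((f z - cell_avg h f i j) * norm z powr - \<alpha>))"
    unfolding cell_error_def cell_avg_mult by (simp add: algebra_simps)
  then show ?thesis unfolding cell_error_def by simp
qed

text \<open>Exchanging the coordinates preserves Lebesgue measure and the norm, transposes the grid,
  and respects the averages, including the special one of the origin cell.\<close>

lemma cell_error_swap:
  assumes "f \<in> borel_measurable borel"
  shows "cell_error \<alpha> h (\<lambda>z. f (snd z, fst z)) i j = cell_error \<alpha> h f j i"
proof -
  define F where "F z = indicator (cell h j i) z *\<^sub>R ((f z - cell_avg h f j i) * norm z powr - \<alpha>)" for z
  have av: "cell_avg h (\<lambda>z. f (snd z, fst z)) i j = cell_avg h f j i"
    by (auto simp: cell_avg_def)
  have nm: "norm (snd z, fst z) = norm z" for z :: "real \<times> real"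
    by (simp add: norm_pair add.commute)
  have ind: "indicator (cell h j i) (snd z, fst z) = (indicator (cell h i j) z :: real)" for z
    by (auto simp: cell_def indicator_def mem_Times_iff)
  have Fm: "F \<in> borel_measurable borel"
    unfolding F_def[abs_def] using assms by measurable
  show ?thesis
    using lborel_pair_swap[OF Fm]
    unfolding F_def nm ind cell_error_def av set_lebesgue_integral_def .
qed

text \<open>The part of the second difference that is homogeneous of degree two is integrated exactly:
  the error of \<open>\<xi>\<^sup>2 / |\<xi>|\<^sup>2\<close> equals that of its mirror image, and the two add up to a constant. A
  cellwise estimate of this part would only give \<open>h\<close> to the power \<open>2 - \<alpha>\<close>.\<close>

lemma quadrature_error_quadratic:
  assumes par: "0 < \<alpha>" "\<alpha> < 2" "0 < h"
  shows "(\<Sum>i<N. \<Sum>j<N. cell_error \<alpha> h (\<lambda>z. (2 * A * (fst z)\<^sup>2 + 2 * B * (snd z)\<^sup>2) / ((fst z)\<^sup>2 + (snd z)\<^sup>2)) i j) = 0"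
proof -
  define q where "q z = (fst z)\<^sup>2 / ((fst z)\<^sup>2 + (snd z)\<^sup>2)" for z :: "real \<times> real"
  define q' where "q' z = q (snd z, fst z)" for z
  have qm: "q \<in> borel_measurable borel" "q' \<in> borel_measurable borel"
    unfolding q'_def[abs_def] q_def[abs_def] atomize_conj
    by (intro conjI borel_measurable_divide) (auto intro!: borel_measurable_continuous_onI continuous_intros)
  have qb: "\<bar>q z\<bar> \<le> 1" "\<bar>q' z\<bar> \<le> 1" for z
  proof -
    have "\<bar>a / (a + b)\<bar> \<le> 1" if "0 \<le> a" "0 \<le> b" for a b :: real
      using that by (cases "a + b = 0") (auto simp: divide_le_eq_1)
    then show "\<bar>q z\<bar> \<le> 1" "\<bar>q' z\<bar> \<le> 1" unfolding q'_def q_def by simp_all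
  qed
  have qq: "q z + q' z = 1" if "z \<noteq> 0" for z
  proof -
    have "(fst z)\<^sup>2 + (snd z)\<^sup>2 \<noteq> 0" using that by (simp add: norm_pair_sq[symmetric])
    then show ?thesis unfolding q'_def q_def by (simp add: add_divide_distrib[symmetric] add.commute)
  qed
  \<comment> \<open>The only point where q + q' is 0 instead of 1 is the origin, and no average
    samples it. Had the origin corner been used, the constant 1 would not be reproduced.\<close>
  have av: "cell_avg h (\<lambda>z. q z + q' z) i j = 1" for i j
    using par(3) by (auto simp: cell_avg_def qq zero_prod_def add_nonneg_eq_0_iff)
  have one: "cell_error \<alpha> h q i j + cell_error \<alpha> h q' i j = 0" for i j
  proof -
    have "cell_error \<alpha> h (\<lambda>z. q z + q' z) i j = (LINT z:cell h i j|lborel. 0)"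
      unfolding cell_error_def av
    proof (intro set_lebesgue_integral_cong allI impI)
      show "(q z + q' z - 1) * norm z powr - \<alpha> = 0" for z
        using qq[of z] by (cases "z = 0") auto
    qed simp
    then show ?thesis
      using cell_error_add[OF par qm(1) qb(1) qm(2) qb(2)] by simp
  qed
  define S where "S = (\<Sum>i<N. \<Sum>j<N. cell_error \<alpha> h q i j)"
  have "(\<Sum>i<N. \<Sum>j<N. cell_error \<alpha> h q' i j) = (\<Sum>i<N. \<Sum>j<N. cell_error \<alpha> h q j i)"
    unfolding q'_def[abs_def] by (simp add: cell_error_swap[OF qm(1)])
  also have "\<dots> = S" unfolding S_def by (rule sum.swap)
  finally have S': "(\<Sum>i<N. \<Sum>j<N. cell_error \<alpha> h q' i j) = S" .
  have "S + S = (\<Sum>i<N. \<Sum>j<N. cell_error \<alpha> h q i j + cell_error \<alpha> h q' i j)"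
    using S' by (simp add: S_def sum.distrib)
  then have S0: "S = 0" by (simp add: one)
  have eq: "(\<lambda>z. (2 * A * (fst z)\<^sup>2 + 2 * B * (snd z)\<^sup>2) / ((fst z)\<^sup>2 + (snd z)\<^sup>2)) = (\<lambda>z. 2 * A * q z + 2 * B * q' z)"
    by (simp add: fun_eq_iff q'_def q_def add_divide_distrib add.commute)
  have lin: "cell_error \<alpha> h (\<lambda>z. 2 * A * q z + 2 * B * q' z) i j = 2 * A * cell_error \<alpha> h q i j + 2 * B * cell_error \<alpha> h q' i j" for i j
  proof -
    have b: "\<bar>2 * A * q z\<bar> \<le> \<bar>2 * A\<bar>" "\<bar>2 * B * q' z\<bar> \<le> \<bar>2 * B\<bar>" for z
      using mult_left_mono[OF qb(1)[of z], of "\<bar>2 * A\<bar>"] mult_left_mono[OF qb(2)[of z], of "\<bar>2 * B\<bar>"] by (simp_all add: abs_mult)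
    show ?thesis
      by (subst cell_error_add[OF par _ b(1) _ b(2)]) (use qm in \<open>simp_all add: cell_error_mult\<close>)
  qed
  show ?thesis
    unfolding eq lin by (simp only: sum.distrib sum_distrib_left[symmetric] S_def[symmetric] S' S0 mult_zero_right add_0_right)
qed

section \<open>Decomposition of the square into cells\<close>

lemma Union_cells:
  assumes "0 \<le> h" "0 < N"
  shows "(\<Union>p\<in>{..<N} \<times> {..<N}. cell h (fst p) (snd p)) = {0..real N * h} \<times> {0..real N * h}"
proof -
  have 1: "(\<Union>i<N. {real i * h..real i * h + h}) = {0..real N * h}"
    using assms(2)
  proof (induction N)
    case (Suc N)
    show ?case
    proof (cases "N = 0")
      case True
      then show ?thesis by (simp add: lessThan_Suc)
    next
      case False
      have "(\<Union>i<Suc N. {real i * h..real i * h + h}) = {real N * h..real N * h + h} \<union> {0..real N * h}"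
        using Suc.IH False by (simp add: lessThan_Suc)
      also have "\<dots> = {0..real (Suc N) * h}"
      proof -
        have "0 \<le> real N * h" using assms(1) by simp
        from ivl_disj_un_two_touch(4)[OF this, of "real N * h + h"] show ?thesis
          using assms(1) by (simp add: algebra_simps Un_commute)
      qed
      finally show ?thesis .
    qed
  qed simp
  have "(\<Union>p\<in>{..<N} \<times> {..<N}. cell h (fst p) (snd p))
      = (\<Union>i<N. {real i * h..real i * h + h}) \<times> (\<Union>i<N. {real i * h..real i * h + h})"
    unfolding cell_def by fastforce
  then show ?thesis unfolding 1 .
qed

text \<open>Closed cells meet only along grid lines. Off the eight lines through their edges a
  common point is interior to both, and then the indices differ by less than one.\<close>

lemma cells_AE_disjoint:
  assumes "0 < h"
  shows "AE z in lborel. z \<in> cell h i j \<and> z \<in> cell h i' j' \<longrightarrow> (i, j) = (i', j')"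
proof -
  have c: "a = b" if "real a * h < t" "t < real a * h + h" "real b * h < t" "t < real b * h + h" for a b :: nat and t
  proof -
    have "real a * h < (real b + 1) * h" "real b * h < (real a + 1) * h" using that by (auto simp: algebra_simps)
    then have "real a < real b + 1" "real b < real a + 1" using assms by auto
    then show ?thesis by linarith
  qed
  note fst' = AE_lborel_fst_neq and snd' = AE_lborel_snd_neq
  show ?thesis
    using fst'[of "real i * h"] fst'[of "real i * h + h"] fst'[of "real i' * h"] fst'[of "real i' * h + h"]
      snd'[of "real j * h"] snd'[of "real j * h + h"] snd'[of "real j' * h"] snd'[of "real j' * h + h"]
  proof eventually_elim
    case (elim z)
    show ?case
    proof
      assume "z \<in> cell h i j \<and> z \<in> cell h i' j'"
      then show "(i, j) = (i', j')"
        using c[of i "fst z" i'] c[of j "snd z" j'] elim unfolding cell_def mem_Times_iff by auto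
    qed
  qed
qed

lemma integral_minus_quadrature:
  fixes f :: "real \<times> real \<Rightarrow> real"
  assumes par: "0 < \<alpha>" "\<alpha> < 2" "0 < h" "0 < N" and fm: "f \<in> borel_measurable borel"
    and fb: "\<And>z. z \<in> {0..real N * h} \<times> {0..real N * h} \<Longrightarrow> \<bar>f z\<bar> \<le> M"
  shows "(LINT z:{0..real N * h} \<times> {0..real N * h}|lborel. f z * norm z powr - \<alpha>)
      - (\<Sum>i<N. \<Sum>j<N. cell_avg h f i j * (LINT z:cell h i j|lborel. norm z powr - \<alpha>))
      = (\<Sum>i<N. \<Sum>j<N. cell_error \<alpha> h f i j)"
proof -
  have h0: "0 \<le> h" and Nh: "0 \<le> real N * h" using par by auto
  note sub = cell_subset[OF h0, of _ N]
  have If: "set_integrable lborel (cell h i j) (\<lambda>z. f z * norm z powr - \<alpha>)" if "i < N" "j < N" for i j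
    by (rule set_integrable_weighted[OF par(1,2) Nh fm cell_sets sub[OF that]]) (use fb sub[OF that] in blast)
  have Iw: "set_integrable lborel (cell h i j) (\<lambda>z. norm z powr - \<alpha>)" if "i < N" "j < N" for i j
    by (rule set_integrable_subset[OF set_integrable_norm_powr_square(1)[OF par(1,2) Nh]]) (use sub[OF that] in auto)
  have "(LINT z:{0..real N * h} \<times> {0..real N * h}|lborel. f z * norm z powr - \<alpha>)
    = (LINT z:(\<Union>p\<in>{..<N} \<times> {..<N}. cell h (fst p) (snd p))|lborel. f z * norm z powr - \<alpha>)"
    unfolding Union_cells[OF h0 par(4)] ..
  also have "\<dots> = (\<Sum>p\<in>{..<N} \<times> {..<N}. LINT z:cell h (fst p) (snd p)|lborel. f z * norm z powr - \<alpha>)"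
    using cells_AE_disjoint[OF par(3)] by (intro set_integral_finite_UN_AE) (auto intro!: If)
  also have "\<dots> = (\<Sum>i<N. \<Sum>j<N. LINT z:cell h i j|lborel. f z * norm z powr - \<alpha>)"
    by (simp add: sum.cartesian_product case_prod_beta)
  finally have 1: "(LINT z:{0..real N * h} \<times> {0..real N * h}|lborel. f z * norm z powr - \<alpha>)
      = (\<Sum>i<N. \<Sum>j<N. LINT z:cell h i j|lborel. f z * norm z powr - \<alpha>)" .
  have 2: "cell_error \<alpha> h f i j = (LINT z:cell h i j|lborel. f z * norm z powr - \<alpha>)
      - cell_avg h f i j * (LINT z:cell h i j|lborel. norm z powr - \<alpha>)" if "i < N" "j < N" for i j
  proof -
    have "cell_error \<alpha> h f i j = (LINT z:cell h i j|lborel. f z * norm z powr - \<alpha> - cell_avg h f i j * norm z powr - \<alpha>)"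
      unfolding cell_error_def by (simp add: algebra_simps)
    also have "\<dots> = (LINT z:cell h i j|lborel. f z * norm z powr - \<alpha>) - (LINT z:cell h i j|lborel. cell_avg h f i j * norm z powr - \<alpha>)"
      by (rule set_integral_diff(2)[OF If[OF that]]) (use Iw[OF that] in simp)
    finally show ?thesis by simp
  qed
  show ?thesis unfolding 1 sum_subtractf[symmetric] by (intro sum.cong refl) (simp add: 2)
qed

section \<open>The two operators\<close>

text \<open>For each cut-off radius e the truncated integral converges absolutely, since u is
  bounded, and can be folded onto the quadrant. The folding produces the symmetric sum, whose
  weighted integral converges absolutely up to the origin by assumption. Dominated convergence then
  removes the cut-off and turns the principal value into an ordinary integral.\<close>

lemma frac_lap_quadrant:
  fixes u :: "real \<times> real \<Rightarrow> real"
  assumes \<alpha>: "0 < \<alpha>" and um: "u \<in> borel_measurable borel" and ub: "\<And>p. \<bar>u p\<bar> \<le> M"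
    and int: "set_integrable lborel ({0<..} \<times> {0<..}) (\<lambda>z. (sum4 u x z - 4 * u x) * norm z powr - (2 + \<alpha>))"
  shows "frac_lap \<alpha> u x = - c_const 2 \<alpha> *
    (LINT z:{0<..} \<times> {0<..}|lborel. (sum4 u x z - 4 * u x) * norm z powr - (2 + \<alpha>))"
proof -
  let ?Q = "{0<..} \<times> {0<..} :: (real \<times> real) set"
  let ?A = "\<lambda>e. {z :: real \<times> real. e < norm z}"
  have Qs [measurable]: "?Q \<in> sets borel" by (intro borel_open open_Times) auto
  have As [measurable]: "?A e \<in> sets borel" for e
    by (intro borel_open open_Collect_less) (auto intro!: continuous_intros)
  define f where "f e z = indicator (?A e) z * ((u x - u (x + z)) * norm z powr - (2 + \<alpha>))" for e z
  define G where "G z = (sum4 u x z - 4 * u x) * norm z powr - (2 + \<alpha>)" for z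
  have utm [measurable]: "(\<lambda>z. u (x + z)) \<in> borel_measurable borel"
    by (rule measurable_compose[OF _ um]) (intro borel_measurable_continuous_onI continuous_intros)
  have fm [measurable]: "f e \<in> borel_measurable borel" for e
    unfolding f_def[abs_def] by measurable
  have fi: "integrable lborel (f e)" if "0 < e" for e
  proof -
    have "set_integrable lborel {z. e \<le> norm z} (\<lambda>z :: real \<times> real. 2 * M * norm z powr - (2 + \<alpha>))"
      using set_integrable_norm_powr_outside[OF \<alpha> that] by simp
    then show ?thesis
      unfolding set_integrable_def
    proof (rule Bochner_Integration.integrable_bound)
      have "\<bar>u x - u (x + z)\<bar> \<le> 2 * M" for z using ub[of x] ub[of "x + z"] by linarith
      then have "\<bar>(u x - u (x + z)) * norm z powr - (2 + \<alpha>)\<bar> \<le> \<bar>2 * M * norm z powr - (2 + \<alpha>)\<bar>" for z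
        unfolding abs_mult by (intro mult_right_mono order_trans[OF _ abs_ge_self[of "2 * M", unfolded abs_mult]]) auto
      then show "AE z in lborel. norm (f e z) \<le> norm (indicat_real {z. e \<le> norm z} z *\<^sub>R (2 * M * norm z powr - (2 + \<alpha>)))"
        by (intro AE_I2) (auto simp: f_def indicator_def)
    qed simp
  qed
  have eq: "integral {x'. dist x x' > e} (\<lambda>x'. (u x - u x') / dist x x' powr (2 + \<alpha>)) = integral\<^sup>L lborel (f e)"
    if "0 < e" for e
  proof -
    define F where "F x' = indicator {x'. dist x x' > e} x' *\<^sub>R ((u x - u x') / dist x x' powr (2 + \<alpha>))" for x'
    have Ff: "F x' = f e (- fst x + 1 * fst x', - snd x + 1 * snd x')" for x'
    proof -
      have "(- fst x + 1 * fst x', - snd x + 1 * snd x') = x' - x" by (simp add: prod_eq_iff)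
      moreover have "norm (x - x') powr - (2 + \<alpha>) = inverse (norm (x - x') powr (2 + \<alpha>))"
        by (rule powr_minus)
      ultimately show ?thesis
        unfolding F_def f_def by (simp add: dist_norm norm_minus_commute divide_inverse indicator_def)
    qed
    have "integrable lborel F"
      unfolding Ff[abs_def] by (rule lborel_pair_affine_sign(2)[OF _ _ fi[OF that]]) auto
    then have "set_integrable lborel {x'. dist x x' > e} (\<lambda>x'. (u x - u x') / dist x x' powr (2 + \<alpha>))"
      unfolding set_integrable_def F_def .
    from set_borel_integral_eq_integral(2)[OF this]
    have "integral {x'. dist x x' > e} (\<lambda>x'. (u x - u x') / dist x x' powr (2 + \<alpha>)) = integral\<^sup>L lborel F"
      unfolding set_lebesgue_integral_def F_def by simp
    also have "\<dots> = integral\<^sup>L lborel (f e)"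
      unfolding Ff[abs_def] by (rule lborel_pair_affine_sign(1)) auto
    finally show ?thesis .
  qed
  define H where "H e z = indicator ?Q z *\<^sub>R (indicator (?A e) z * - G z)" for e z
  have Gm: "(\<lambda>z. indicator ?Q z *\<^sub>R G z) \<in> borel_measurable borel"
    using int unfolding set_integrable_def G_def[abs_def] by auto
  have Hm: "H e \<in> borel_measurable lborel" for e
  proof -
    have "H e = (\<lambda>z. - (indicator (?A e) z * (indicator ?Q z *\<^sub>R G z)))"
      by (simp add: H_def fun_eq_iff)
    then show ?thesis using Gm by simp
  qed
  have fH: "integral\<^sup>L lborel (f e) = integral\<^sup>L lborel (H e)" if "0 < e" for e
  proof -
    have n: "norm (a, b) = norm z" if "\<bar>a\<bar> = \<bar>fst z\<bar>" "\<bar>b\<bar> = \<bar>snd z\<bar>" for a b and z :: "real \<times> real"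
      using that by (auto intro!: antisym norm_pair_mono)
    have "f e (fst z, snd z) + f e (fst z, - snd z) + f e (- fst z, snd z) + f e (- fst z, - snd z)
      = indicator (?A e) z * - G z" for z
    proof -
      have "norm (fst z, - snd z) = norm z" "norm (- fst z, snd z) = norm z" "norm (- fst z, - snd z) = norm z"
        by (auto intro!: n)
      then show ?thesis
        unfolding f_def G_def sum4_def plus_prod_def by (simp add: indicator_def algebra_simps)
    qed
    then show ?thesis
      unfolding integral_fold_quadrant[OF fi[OF that]] H_def set_lebesgue_integral_def by simp
  qed
  \<comment> \<open>The limit e to 0 from the right is taken as t to infinity with e = 1 / t; the
    dominating function is the absolute value of the folded integrand without cut-off.\<close>
  have "((\<lambda>t. integral\<^sup>L lborel (H (inverse t))) \<longlongrightarrow> integral\<^sup>L lborel (\<lambda>z. indicator ?Q z *\<^sub>R - G z)) at_top"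
  proof (rule integral_dominated_convergence_at_top[where w = "\<lambda>z. \<bar>indicator ?Q z *\<^sub>R G z\<bar>"])
    show "(\<lambda>z. indicator ?Q z *\<^sub>R - G z) \<in> borel_measurable lborel"
      using borel_measurable_uminus[OF Gm] by simp
    show "integrable lborel (\<lambda>z. \<bar>indicator ?Q z *\<^sub>R G z\<bar>)"
      using int unfolding set_integrable_def G_def by (rule integrable_abs)
    show "AE z in lborel. ((\<lambda>t. H (inverse t) z) \<longlongrightarrow> indicator ?Q z *\<^sub>R - G z) at_top"
    proof (rule AE_I2)
      fix z :: "real \<times> real"
      show "((\<lambda>t. H (inverse t) z) \<longlongrightarrow> indicator ?Q z *\<^sub>R - G z) at_top"
      proof (rule tendsto_eventually)
        have "\<forall>\<^sub>F t in at_top. norm z > 0 \<longrightarrow> inverse t < norm z"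
          using order_tendstoD(2)[OF tendsto_inverse_0_at_top[OF filterlim_ident], of "norm z"]
          by (cases "0 < norm z") auto
        then show "\<forall>\<^sub>F t in at_top. H (inverse t) z = indicator ?Q z *\<^sub>R - G z"
        proof eventually_elim
          case (elim t)
          then show ?case by (auto simp: H_def indicator_def zero_prod_def)
        qed
      qed
    qed
    show "\<forall>\<^sub>F t in at_top. AE z in lborel. norm (H (inverse t) z) \<le> \<bar>indicator ?Q z *\<^sub>R G z\<bar>"
      by (intro always_eventually allI AE_I2) (auto simp: H_def indicator_def)
  qed (rule Hm)
  then have "((\<lambda>e. integral\<^sup>L lborel (H e)) \<longlongrightarrow> integral\<^sup>L lborel (\<lambda>z. indicator ?Q z *\<^sub>R - G z)) (at_right 0)"
    by (simp add: filterlim_at_right_to_top)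
  then have "((\<lambda>e. integral {x'. dist x x' > e} (\<lambda>x'. (u x - u x') / dist x x' powr (2 + \<alpha>)))
      \<longlongrightarrow> integral\<^sup>L lborel (\<lambda>z. indicator ?Q z *\<^sub>R - G z)) (at_right 0)"
    by (rule Lim_transform_eventually)
       (auto simp: eq fH eventually_at_right_less intro!: eventually_mono[OF eventually_at_right_less[of 0]])
  from tendsto_Lim[OF _ this]
  have "Lim (at_right 0) (\<lambda>e. integral {x'. dist x x' > e} (\<lambda>x'. (u x - u x') / dist x x' powr (2 + \<alpha>)))
      = integral\<^sup>L lborel (\<lambda>z. indicator ?Q z *\<^sub>R - G z)"
    by simp
  then show ?thesis
    unfolding frac_lap_def G_def set_lebesgue_integral_def by simp
qed

lemma psi_g_2: "psi_g 2 u x z = norm z powr - 2 * (sum4 u x z - 4 * u x)"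
  by (simp add: psi_g_def sum4_def)

lemma sum4_measurable:
  assumes "continuous_on UNIV u"
  shows "sum4 u x \<in> borel_measurable borel"
proof -
  have c: "continuous_on UNIV (\<lambda>z. u (p z))" if "continuous_on UNIV p" for p :: "real \<times> real \<Rightarrow> real \<times> real"
    using continuous_on_compose2[OF assms that] by auto
  then show ?thesis
    unfolding sum4_def[abs_def]
    by (intro borel_measurable_continuous_onI continuous_on_add c) (auto intro!: continuous_intros)
qed

text \<open>Inside the square the kernel is regrouped as |z|^(-2) * |z|^(-alpha), the first factor
  going into \<open>psi_g\<close>. Outside, all four shifted points leave the support of u and only
  the centre value remains. The bound P provides integrability and does not enter the
  result.\<close>

lemma frac_lap_split:
  fixes u :: "real \<times> real \<Rightarrow> real"
  assumes \<alpha>: "0 < \<alpha>" "\<alpha> < 2" and u: "continuous_on UNIV u" "\<And>p. \<bar>u p\<bar> \<le> M" and L: "0 < L"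
    and far: "\<And>z. L < fst z \<or> L < snd z \<Longrightarrow> sum4 u x z = 0"
    and bd: "\<And>z. z \<in> {0..L} \<times> {0..L} \<Longrightarrow> \<bar>psi_g 2 u x z\<bar> \<le> P"
  shows "frac_lap \<alpha> u x = - c_const 2 \<alpha> *
    ((LINT z:{0..L} \<times> {0..L}|lborel. psi_g 2 u x z * norm z powr - \<alpha>)
      - 4 * u x * integral (({0..} \<times> {0..}) - {0<..<L} \<times> {0<..<L}) (\<lambda>z. norm z powr - (2 + \<alpha>)))"
proof -
  let ?Q = "{0<..} \<times> {0<..} :: (real \<times> real) set"
  let ?S = "{0..L} \<times> {0..L} :: (real \<times> real) set"
  let ?D = "({0..} \<times> {0..}) - {0<..<L} \<times> {0<..<L} :: (real \<times> real) set"
  let ?r = "\<lambda>z :: real \<times> real. norm z powr - (2 + \<alpha>)"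
  have um: "u \<in> borel_measurable borel" using u(1) by (rule borel_measurable_continuous_onI)
  have [measurable]: "?Q \<in> sets borel" by (intro borel_open open_Times) auto
  have [measurable]: "?S \<in> sets borel" by (intro borel_closed closed_Times) auto
  have [measurable]: "?D \<in> sets borel"
    by (intro sets.Diff borel_closed borel_open closed_Times open_Times) auto
  have [measurable]: "sum4 u x \<in> borel_measurable borel" by (rule sum4_measurable[OF u(1)])
  have pm [measurable]: "psi_g 2 u x \<in> borel_measurable borel"
    unfolding psi_g_2[abs_def] by measurable
  define G where "G z = (sum4 u x z - 4 * u x) * ?r z" for z
  have G: "G z = psi_g 2 u x z * norm z powr - \<alpha>" for z
  proof -
    have "?r z = norm z powr - 2 * norm z powr - \<alpha>" by (simp add: powr_add[symmetric])
    then show ?thesis unfolding G_def psi_g_2 by (simp only: mult_ac)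
  qed
  have [measurable]: "G \<in> borel_measurable borel" unfolding G_def[abs_def] by measurable
  have IS: "set_integrable lborel ?S G"
    unfolding G[abs_def] by (rule set_integrable_weighted[OF \<alpha> less_imp_le[OF L] pm _ _ bd]) auto
  then have I1: "set_integrable lborel (?Q \<inter> ?S) G"
    by (rule set_integrable_subset) auto
  have sub: "?Q - ?S \<subseteq> {z. L \<le> norm z}"
  proof
    fix z assume "z \<in> ?Q - ?S"
    then show "z \<in> {z. L \<le> norm z}"
      using abs_fst_le_norm[of z] abs_snd_le_norm[of z] by (auto simp: mem_Times_iff)
  qed
  have Ir: "set_integrable lborel (?Q - ?S) ?r"
    by (rule set_integrable_subset[OF set_integrable_norm_powr_outside[OF \<alpha>(1) L] _ sub]) simp
  have Geq: "G z = - 4 * u x * ?r z" if "z \<in> ?Q - ?S" for z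
    using that far[of z] by (auto simp: G_def mem_Times_iff)
  have I2: "set_integrable lborel (?Q - ?S) G"
    by (rule set_integrable_cong[THEN iffD1, OF refl refl _ set_integrable_mult_right[OF Ir, of "- 4 * u x"]])
       (use Geq in auto)
  have U: "?Q = (?Q \<inter> ?S) \<union> (?Q - ?S)" by blast
  have IQ: "set_integrable lborel ?Q G"
    by (subst U, rule set_integrable_Un[OF I1 I2]) auto
  have "(LINT z:?Q|lborel. G z) = (LINT z:?Q \<inter> ?S|lborel. G z) + (LINT z:?Q - ?S|lborel. G z)"
    by (subst U, rule set_integral_Un[OF _ I1 I2]) blast
  also have "(LINT z:?Q \<inter> ?S|lborel. G z) = (LINT z:?S|lborel. G z)"
  proof (rule set_integral_cong_set)
    show "AE z in lborel. (z \<in> ?S) = (z \<in> ?Q \<inter> ?S)"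
      using AE_lborel_fst_neq[of 0] AE_lborel_snd_neq[of 0] by eventually_elim (auto simp: mem_Times_iff)
  qed (auto simp: set_borel_measurable_def)
  also have "(LINT z:?Q - ?S|lborel. G z) = (LINT z:?Q - ?S|lborel. - 4 * u x * ?r z)"
    by (rule set_lebesgue_integral_cong) (use Geq in auto)
  also have "\<dots> = - 4 * u x * (LINT z:?Q - ?S|lborel. ?r z)"
    by (rule set_integral_mult_right)
  also have "(LINT z:?Q - ?S|lborel. ?r z) = integral ?D ?r"
  proof -
    \<comment> \<open>\<open>?D\<close> contains parts of the axes and of the edges at L that are
      missing from \<open>?Q - ?S\<close>; all of them lie on four lines of measure zero.\<close>
    have AE: "AE z in lborel. (z \<in> ?D) = (z \<in> ?Q - ?S)"
      using AE_lborel_fst_neq[of 0] AE_lborel_snd_neq[of 0] AE_lborel_fst_neq[of L] AE_lborel_snd_neq[of L]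
      by eventually_elim (auto simp: mem_Times_iff)
    have "(LINT z:?Q - ?S|lborel. ?r z) = (LINT z:?D|lborel. ?r z)"
      by (rule set_integral_cong_set[OF _ _ AE]) (auto simp: set_borel_measurable_def)
    moreover have "set_integrable lborel ?D ?r"
      using Ir unfolding set_integrable_def
    proof (rule integrable_cong_AE[THEN iffD1, rotated 3])
      show "AE z in lborel. indicat_real (?Q - ?S) z *\<^sub>R ?r z = indicat_real ?D z *\<^sub>R ?r z"
        using AE by eventually_elim (simp only: indicator_def)
    qed auto
    ultimately show ?thesis using set_borel_integral_eq_integral(2) by metis
  qed
  finally have "(LINT z:?Q|lborel. G z) = (LINT z:?S|lborel. G z) + - 4 * u x * integral ?D ?r" .
  moreover have "frac_lap \<alpha> u x = - c_const 2 \<alpha> * (LINT z:?Q|lborel. G z)"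
    using frac_lap_quadrant[OF \<alpha>(1) um u(2), of x] IQ unfolding G_def by blast
  ultimately show ?thesis unfolding G[abs_def] by simp
qed

text \<open>The scheme is brought to the shape of \<open>frac_lap_split\<close> with an identical
  outer term, so that the difference of the operators is the integral minus the quadrature over the
  square.\<close>

lemma disc_frac_lap_cells:
  fixes a1 b1 a2 b2 :: real and N :: nat
  defines "L \<equiv> max (b1 - a1) (b2 - a2)"
  defines "h \<equiv> L / real N"
  assumes \<alpha>: "0 < \<alpha>" "\<alpha> < 2" and L: "0 < L" and N: "0 < N"
  shows "disc_frac_lap \<alpha> 2 a1 b1 a2 b2 N u x = - c_const 2 \<alpha> *
    ((\<Sum>i<N. \<Sum>j<N. cell_avg h (psi_g 2 u x) i j * (LINT z:cell h i j|lborel. norm z powr - \<alpha>))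
      - 4 * u x * integral (({0..} \<times> {0..}) - {0<..<L} \<times> {0<..<L}) (\<lambda>z. norm z powr - (2 + \<alpha>)))"
proof -
  define W where "W i j = (LINT z:cell h i j|lborel. norm z powr - \<alpha>)" for i j
  define p where "p = psi_g 2 u x"
  have h: "0 < h" and Nh: "real N * h = L" using L N by (auto simp: h_def)
  have om: "omega_g \<alpha> 2 = (\<lambda>z. norm z powr - \<alpha>)"
    by (simp add: omega_g_def fun_eq_iff)
  have cb: "cbox (real i * h, real j * h) (real (i + 1) * h, real (j + 1) * h) = cell h i j" for i j
    unfolding cbox_Pair_eq cell_def by (simp add: algebra_simps)
  have W: "integral (cell h i j) (\<lambda>z. norm z powr - \<alpha>) = W i j" if "i < N" "j < N" for i j
  proof -
    have h0: "0 \<le> h" "0 \<le> real N * h" using h by auto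
    have "set_integrable lborel (cell h i j) (\<lambda>z. norm z powr - \<alpha>)"
      by (rule set_integrable_subset[OF set_integrable_norm_powr_square(1)[OF \<alpha> h0(2)] _ cell_subset[OF h0(1) that]]) simp
    from set_borel_integral_eq_integral(2)[OF this] show ?thesis unfolding W_def by simp
  qed
  have av: "1/4 * (\<Sum>m\<in>{0, 1}. \<Sum>n\<in>{0, 1}. p (real (i + m) * h, real (j + n) * h)) = cell_avg h p i j"
    if "(i, j) \<noteq> (0, 0)" for i j
    using that unfolding cell_avg_def by (auto simp: algebra_simps)
  have "(\<Sum>i<N. \<Sum>j<N. cell_avg h p i j * W i j) = (\<Sum>(i, j)\<in>{0..<N} \<times> {0..<N}. cell_avg h p i j * W i j)"
    by (simp add: sum.cartesian_product atLeast0LessThan)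
  also have "\<dots> = cell_avg h p 0 0 * W 0 0 + (\<Sum>(i, j)\<in>{0..<N} \<times> {0..<N} - {(0, 0)}. cell_avg h p i j * W i j)"
    using N by (subst sum.remove[of _ "(0, 0)"]) auto
  also have "(\<Sum>(i, j)\<in>{0..<N} \<times> {0..<N} - {(0, 0)}. cell_avg h p i j * W i j)
      = 1/4 * (\<Sum>(i, j)\<in>{0..<N} \<times> {0..<N} - {(0, 0)}.
        (\<Sum>m\<in>{0, 1}. \<Sum>n\<in>{0, 1}. p (real (i + m) * h, real (j + n) * h)) * integral (cell h i j) (\<lambda>z. norm z powr - \<alpha>))"
    unfolding sum_distrib_left
  proof (rule sum.cong[OF refl], goal_cases)
    case (1 p')
    obtain i j where p': "p' = (i, j)" by force
    then have ij: "i < N" "j < N" "(i, j) \<noteq> (0, 0)" using 1 by auto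
    show ?case
      unfolding p' prod.case W[OF ij(1,2)] av[OF ij(3), symmetric] by simp
  qed
  finally have sum: "(\<Sum>i<N. \<Sum>j<N. cell_avg h p i j * W i j) = cell_avg h p 0 0 * W 0 0
    + 1/4 * (\<Sum>(i, j)\<in>{0..<N} \<times> {0..<N} - {(0, 0)}.
        (\<Sum>m\<in>{0, 1}. \<Sum>n\<in>{0, 1}. p (real (i + m) * h, real (j + n) * h)) * integral (cell h i j) (\<lambda>z. norm z powr - \<alpha>))" .
  have av0: "cell_avg h p 0 0 * W 0 0 = 1/4 * (c_coef 2 1 0 * p (real 1 * h, real 0 * h) + c_coef 2 0 1 * p (real 0 * h, real 1 * h)
      + c_coef 2 1 1 * p (real 1 * h, real 1 * h)) * integral (cell h 0 0) (\<lambda>z. norm z powr - \<alpha>)"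
    using W[of 0 0] N by (simp add: cell_avg_def c_coef_def)
  show ?thesis
    unfolding disc_frac_lap_def Let_def L_def[symmetric] h_def[symmetric] om cb p_def[symmetric] W_def[symmetric] sum av0
    by simp
qed

theorem theorem2:
  fixes \<alpha> \<epsilon> a1 b1 a2 b2 :: real and u :: "real \<times> real \<Rightarrow> real"
  assumes "0 < \<alpha>" "\<alpha> < 2"
    and "a1 < b1" "a2 < b2"
    and "\<forall>p. p \<notin> {a1<..<b1} \<times> {a2<..<b2} \<longrightarrow> u p = 0"
    and "0 < \<epsilon>" "\<epsilon> \<le> 1 + of_int \<lfloor>\<alpha>\<rfloor> - \<alpha>"
    and "u \<in> holder_space (2 + nat \<lfloor>\<alpha>\<rfloor>) (\<alpha> - of_int \<lfloor>\<alpha>\<rfloor> + \<epsilon>)"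
  shows "\<exists>C>0. \<exists>h0>0. \<forall>N::nat. 0 < N \<longrightarrow> max (b1 - a1) (b2 - a2) / real N < h0 \<longrightarrow>
           (\<forall>x \<in> {a1<..<b1} \<times> {a2<..<b2}.
              \<bar>frac_lap \<alpha> u x - disc_frac_lap \<alpha> 2 a1 b1 a2 b2 N u x\<bar>
                \<le> C * (max (b1 - a1) (b2 - a2) / real N) ^ 2)"
proof -
  define L where "L = max (b1 - a1) (b2 - a2)"
  have L: "0 < L" "b1 - a1 \<le> L" "b2 - a2 \<le> L" using assms(3,4) by (auto simp: L_def)
  define \<sigma> where "\<sigma> = \<alpha> + \<epsilon>"
  \<comment> \<open>The range of \<open>\<epsilon>\<close> is used in two forms:
    \<open>\<epsilon>\<close> <= 1 for the power sums, and \<open>\<sigma>\<close> <= 2 so that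
    r^(\<open>\<sigma>\<close> - 2) does not increase with r and the near corner of a cell is the
    worst one.\<close>
  have "\<lfloor>\<alpha>\<rfloor> \<le> 1" using assms(2) by linarith
  then have "real_of_int \<lfloor>\<alpha>\<rfloor> \<le> 1" by simp
  moreover have "real_of_int \<lfloor>\<alpha>\<rfloor> \<le> \<alpha>" by simp
  ultimately have \<sigma>: "\<epsilon> \<le> 1" "\<sigma> \<le> 2" using assms(7) unfolding \<sigma>_def by linarith+
  have uc: "continuous_on UNIV u"
    using assms(8) unfolding holder_space_def by (auto dest!: spec[of _ "[]"])
  obtain M where M: "\<And>p. \<bar>u p\<bar> \<le> M"
  proof -
    have "bounded (u ` cbox (a1, a2) (b1, b2))"
      by (intro compact_imp_bounded compact_continuous_image continuous_on_subset[OF uc]) auto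
    then obtain M where M: "\<And>p. p \<in> cbox (a1, a2) (b1, b2) \<Longrightarrow> \<bar>u p\<bar> \<le> M"
      unfolding bounded_iff by auto
    have "\<bar>u p\<bar> \<le> max 0 M" for p
    proof (cases "p \<in> {a1<..<b1} \<times> {a2<..<b2}")
      case True
      then have "p \<in> cbox (a1, a2) (b1, b2)" by (auto simp: cbox_Pair_eq)
      then show ?thesis using M[of p] by simp
    next
      case False
      then have "u p = 0" using assms(5) by blast
      then show ?thesis by simp
    qed
    then show thesis using that by blast
  qed
  \<comment> \<open>K is fixed before x. The coefficients A and B obtained later depend on x and
    enter only the boundedness of \<open>psi_g 2 u x\<close>, never the final constant.\<close>
  obtain K where K: "0 \<le> K" "\<And>x. \<exists>A B gx gxx gy gyy. vanishing_order \<sigma> K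
      (\<lambda>z. sum4 u x z - 4 * u x - 2 * A * (fst z)\<^sup>2 - 2 * B * (snd z)\<^sup>2) gx gxx gy gyy"
    using second_difference_vanishing_order[OF assms(1,2,6,8)] unfolding \<sigma>_def by blast
  define C0 where "C0 = K * (680 / \<epsilon> + 10 / (1 - \<alpha> / 2)\<^sup>2) * L powr \<epsilon>"
  have main: "\<bar>frac_lap \<alpha> u x - disc_frac_lap \<alpha> 2 a1 b1 a2 b2 N u x\<bar> \<le> \<bar>c_const 2 \<alpha>\<bar> * (C0 * (L / real N)\<^sup>2)"
    if N: "0 < N" and x: "x \<in> {a1<..<b1} \<times> {a2<..<b2}" for N x
  proof -
    define h where "h = L / real N"
    have h: "0 < h" and Nh: "real N * h = L" using N L by (auto simp: h_def)
    obtain A B gx gxx gy gyy where g0: "vanishing_order \<sigma> K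
      (\<lambda>z. sum4 u x z - 4 * u x - 2 * A * (fst z)\<^sup>2 - 2 * B * (snd z)\<^sup>2) gx gxx gy gyy"
      using K(2) by blast
    define g where "g z = sum4 u x z - 4 * u x - 2 * A * (fst z)\<^sup>2 - 2 * B * (snd z)\<^sup>2" for z
    have g: "vanishing_order \<sigma> K g gx gxx gy gyy" using g0 unfolding g_def[abs_def] .
    have gm: "g \<in> borel_measurable borel"
      unfolding g_def[abs_def] using sum4_measurable[OF uc, of x]
      by (intro borel_measurable_diff borel_measurable_const) (auto intro!: borel_measurable_continuous_onI continuous_intros)
    define q where "q z = (2 * A * (fst z)\<^sup>2 + 2 * B * (snd z)\<^sup>2) / ((fst z)\<^sup>2 + (snd z)\<^sup>2)" for z
    define \<phi> where "\<phi> z = g z / ((fst z)\<^sup>2 + (snd z)\<^sup>2)" for z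
    have qm: "q \<in> borel_measurable borel" and \<phi>m: "\<phi> \<in> borel_measurable borel"
      unfolding q_def[abs_def] \<phi>_def[abs_def] using gm
      by (intro borel_measurable_divide; auto intro!: borel_measurable_continuous_onI continuous_intros)+
    have psi: "psi_g 2 u x = (\<lambda>z. q z + \<phi> z)"
    proof
      fix z :: "real \<times> real"
      have "norm z powr - 2 = 1 / ((fst z)\<^sup>2 + (snd z)\<^sup>2)" if "z \<noteq> 0"
        using that by (simp add: powr_minus_divide norm_pair_sq[symmetric])
      \<comment> \<open>At z = 0 both sides are 0, because \<open>0 powr - 2\<close> and division by
        0 are 0.\<close>
      then show "psi_g 2 u x z = q z + \<phi> z"
        by (cases "z = 0") (auto simp: psi_g_2 q_def \<phi>_def g_def add_divide_distrib[symmetric])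
    qed
    have qb: "\<bar>q z\<bar> \<le> 2 * (\<bar>A\<bar> + \<bar>B\<bar>)" for z
    proof (cases "(fst z)\<^sup>2 + (snd z)\<^sup>2 = 0")
      case False
      then have pos: "0 < (fst z)\<^sup>2 + (snd z)\<^sup>2" by (simp add: less_le)
      have "\<bar>2 * A * (fst z)\<^sup>2 + 2 * B * (snd z)\<^sup>2\<bar> \<le> 2 * \<bar>A\<bar> * (fst z)\<^sup>2 + 2 * \<bar>B\<bar> * (snd z)\<^sup>2"
        by (rule order_trans[OF abs_triangle_ineq]) (simp add: abs_mult)
      also have "\<dots> \<le> 2 * (\<bar>A\<bar> + \<bar>B\<bar>) * ((fst z)\<^sup>2 + (snd z)\<^sup>2)"
        by (simp add: algebra_simps)
      finally show ?thesis using pos by (simp add: q_def abs_divide divide_le_eq)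
    qed (simp add: q_def)
    have \<phi>b: "\<bar>\<phi> z\<bar> \<le> 2 * K * (2 * L) powr \<sigma>" if "z \<in> {0..L} \<times> {0..L}" for z
    proof (cases "z = 0")
      case False
      have "norm z \<le> \<bar>fst z\<bar> + \<bar>snd z\<bar>" using norm_Pair_le[of "fst z" "snd z"] by simp
      then have "norm z \<le> 2 * L" using that by auto
      have "\<bar>\<phi> z\<bar> \<le> 2 * K * norm z powr \<sigma>"
        using quot_bounds(1)[of "norm z" "fst z" "snd z" "\<lambda>t. g (t, snd z)" K \<sigma> "\<lambda>t. gx (t, snd z)" "\<lambda>t. gxx (t, snd z)"]
          norm_pair_sq[of z] g False unfolding \<phi>_def vanishing_order_def by simp
      also have "\<dots> \<le> 2 * K * (2 * L) powr \<sigma>"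
        using \<open>norm z \<le> 2 * L\<close> K(1) assms(1,6) by (intro mult_left_mono powr_mono2) (auto simp: \<sigma>_def)
      finally show ?thesis .
    qed (use K(1) in \<open>simp add: \<phi>_def\<close>)
    have pb: "\<bar>psi_g 2 u x z\<bar> \<le> 2 * (\<bar>A\<bar> + \<bar>B\<bar>) + 2 * K * (2 * L) powr \<sigma>" if "z \<in> {0..L} \<times> {0..L}" for z
      unfolding psi by (rule order_trans[OF abs_triangle_ineq add_mono[OF qb \<phi>b[OF that]]])
    have pm: "psi_g 2 u x \<in> borel_measurable borel"
      unfolding psi using qm \<phi>m by (rule borel_measurable_add)
    \<comment> \<open>L is at least both side lengths of the rectangle, so a shift by more than L in
      one coordinate, in either direction, leaves the rectangle from any of its points.\<close>
    have far: "sum4 u x z = 0" if "L < fst z \<or> L < snd z" for z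
    proof -
      have "u (fst x + s * fst z, snd x + t * snd z) = 0" if "s = 1 \<or> s = - 1" "t = 1 \<or> t = - 1" for s t :: real
      proof -
        have "(fst x + s * fst z, snd x + t * snd z) \<notin> {a1<..<b1} \<times> {a2<..<b2}"
          using x that \<open>L < fst z \<or> L < snd z\<close> L by (auto simp: mem_Times_iff)
        then show ?thesis using assms(5) by blast
      qed
      from this[of 1 1] this[of 1 "-1"] this[of "-1" 1] this[of "-1" "-1"] show ?thesis
        by (simp add: sum4_def)
    qed
    note fl = frac_lap_split[OF assms(1,2) uc M L(1) far pb]
    note dl = disc_frac_lap_cells[OF assms(1,2) L(1)[unfolded L_def] N, folded L_def h_def, of u x]
    note qe = integral_minus_quadrature[OF assms(1,2) h N pm, unfolded Nh, OF pb]
    have "frac_lap \<alpha> u x - disc_frac_lap \<alpha> 2 a1 b1 a2 b2 N u x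
      = - c_const 2 \<alpha> * (\<Sum>i<N. \<Sum>j<N. cell_error \<alpha> h (psi_g 2 u x) i j)"
      by (subst qe[symmetric], assumption, subst dl, subst fl, assumption, assumption) (simp add: algebra_simps)
    also have "(\<Sum>i<N. \<Sum>j<N. cell_error \<alpha> h (psi_g 2 u x) i j) = (\<Sum>i<N. \<Sum>j<N. cell_error \<alpha> h \<phi> i j)"
    proof -
      have "cell_error \<alpha> h (psi_g 2 u x) i j = cell_error \<alpha> h q i j + cell_error \<alpha> h \<phi> i j" if "i < N" "j < N" for i j
        unfolding psi
        by (rule cell_error_add[OF assms(1,2) h qm qb \<phi>m \<phi>b])
           (use cell_subset[of h i N j, unfolded Nh] h that in auto)
      then have "(\<Sum>i<N. \<Sum>j<N. cell_error \<alpha> h (psi_g 2 u x) i j)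
        = (\<Sum>i<N. \<Sum>j<N. cell_error \<alpha> h q i j) + (\<Sum>i<N. \<Sum>j<N. cell_error \<alpha> h \<phi> i j)"
        by (simp add: sum.distrib)
      then show ?thesis using quadrature_error_quadratic[OF assms(1,2) h, of A B N] by (simp add: q_def[abs_def])
    qed
    finally have "\<bar>frac_lap \<alpha> u x - disc_frac_lap \<alpha> 2 a1 b1 a2 b2 N u x\<bar>
        = \<bar>c_const 2 \<alpha>\<bar> * \<bar>\<Sum>i<N. \<Sum>j<N. cell_error \<alpha> h \<phi> i j\<bar>" by (simp add: abs_mult)
    also have "\<dots> \<le> \<bar>c_const 2 \<alpha>\<bar> * (C0 * h\<^sup>2)"
      using quadrature_error_vanishing[OF g K(1) assms(1,2,6) \<sigma>(1) \<sigma>_def \<sigma>(2) h gm, of N]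
      unfolding Nh C0_def \<phi>_def[abs_def] by (intro mult_left_mono) auto
    finally show ?thesis unfolding h_def .
  qed
  have C0: "0 \<le> C0" using K(1) assms(6) by (simp add: C0_def)
  have "\<bar>frac_lap \<alpha> u x - disc_frac_lap \<alpha> 2 a1 b1 a2 b2 N u x\<bar> \<le> (\<bar>c_const 2 \<alpha>\<bar> * C0 + 1) * (L / real N)\<^sup>2"
    if "0 < N" "x \<in> {a1<..<b1} \<times> {a2<..<b2}" for N x
    using main[OF that] by (rule order_trans) (simp add: algebra_simps)
  \<comment> \<open>The summand 1 only makes the constant positive. The estimate holds for every
    positive N, so the threshold \<open>h0\<close> can be any positive number, here 1.\<close>
  moreover have "0 < \<bar>c_const 2 \<alpha>\<bar> * C0 + 1" using C0 by (simp add: add_nonneg_pos)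
  ultimately show ?thesis unfolding L_def by (intro exI[of _ "\<bar>c_const 2 \<alpha>\<bar> * C0 + 1"] exI[of _ 1] conjI) auto
qed

end
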